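(* Consider the problem: given an ordered graph $G$ and an ordered matching $M$, decide whether there exists an ordered homomorphism $G\to M$. This problem is fixed-parameter tractable when parameterized by $|V(M)|$.
   Context: An ordered graph is a finite simple graph whose vertex set is equipped with a total (linear) order. An ordered matching is an ordered graph in which every vertex is incident to exactly one edge. For ordered graphs $G,H$, an ordered homomorphism $f:G\to H$ is a map $f:V(G)\to V(H)$ such that $uv\in E(G)$ implies $f(u)f(v)\in E(H)$, and $u\le v$ implies $f(u)\le f(v)$. *)

theory Defs
  imports Main
begin

section \<open>Ordered graphs\<close>

record 'a ograph =
  verts :: "'a set"
  edges :: "'a set set"
  le :: "'a rel"

definition ordered_graph :: "'a ograph \<Rightarrow> bool" where
  "ordered_graph G \<longleftrightarrow>
     finite (verts G) \<and>
     (\<forall>e \<in> edges G. e \<subseteq> verts G \<and> card e = 2) \<and>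
     linear_order_on (verts G) (le G)"

definition ordered_matching :: "'a ograph \<Rightarrow> bool" where
  "ordered_matching M \<longleftrightarrow>
     ordered_graph M \<and> (\<forall>v \<in> verts M. \<exists>!e. e \<in> edges M \<and> v \<in> e)"

definition ordered_hom :: "('a \<Rightarrow> 'b) \<Rightarrow> 'a ograph \<Rightarrow> 'b ograph \<Rightarrow> bool" where
  "ordered_hom f G H \<longleftrightarrow>
     (\<forall>v \<in> verts G. f v \<in> verts H) \<and>
     (\<forall>u v. {u, v} \<in> edges G \<longrightarrow> {f u, f v} \<in> edges H) \<and>
     (\<forall>u v. (u, v) \<in> le G \<longrightarrow> (f u, f v) \<in> le H)"


section \<open>A random access machine\<close>

text \<open>
  Programs are structured programs of a unit-cost random access machine. A state consists of
  registers, of which a program mentions only finitely many, and of an indirectly addressable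
  memory; both hold natural numbers. The only arithmetic is addition and truncated subtraction,
  so that, apart from loading a constant of the program, one step lengthens the binary
  representation of the largest number in the state by at most one bit. Hence running times
  are polynomially related to those of Turing machines.
\<close>

type_synonym state = "(nat \<Rightarrow> nat) \<times> (nat \<Rightarrow> nat)"

datatype com =
    Const nat nat
  | Add nat nat nat
  | Sub nat nat nat
  | Load nat nat
  | Store nat nat
  | Seq com com
  | IfZero nat com com
  | WhileNonzero nat com

text \<open>
  \<open>exec c s t s'\<close>: started in state \<open>s\<close>, the program \<open>c\<close> halts after \<open>t\<close> steps in state \<open>s'\<close>.
  Every executed basic instruction and every executed test counts as one step.
\<close>

inductive exec :: "com \<Rightarrow> state \<Rightarrow> nat \<Rightarrow> state \<Rightarrow> bool" where
  Const: "exec (Const r n) (R, m) 1 (R(r := n), m)"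
| Add: "exec (Add r p q) (R, m) 1 (R(r := R p + R q), m)"
| Sub: "exec (Sub r p q) (R, m) 1 (R(r := R p - R q), m)"
| Load: "exec (Load r p) (R, m) 1 (R(r := m (R p)), m)"
| Store: "exec (Store p q) (R, m) 1 (R, m(R p := R q))"
| Seq: "exec c s t s' \<Longrightarrow> exec d s' t' s'' \<Longrightarrow> exec (Seq c d) s (t + t') s''"
| IfZero_True: "R r = 0 \<Longrightarrow> exec c (R, m) t s' \<Longrightarrow> exec (IfZero r c d) (R, m) (Suc t) s'"
| IfZero_False: "R r \<noteq> 0 \<Longrightarrow> exec d (R, m) t s' \<Longrightarrow> exec (IfZero r c d) (R, m) (Suc t) s'"
| While_End: "R r = 0 \<Longrightarrow> exec (WhileNonzero r c) (R, m) 1 (R, m)"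
| While_Step: "R r \<noteq> 0 \<Longrightarrow> exec c (R, m) t s' \<Longrightarrow> exec (WhileNonzero r c) s' t' s'' \<Longrightarrow>
    exec (WhileNonzero r c) (R, m) (Suc (t + t')) s''"

lemma exec_deterministic:
  "exec c s t s' \<Longrightarrow> exec c s u s'' \<Longrightarrow> u = t \<and> s'' = s'"
proof (induction arbitrary: u s'' rule: exec.induct)
  case (Const r n R m)
  from Const.prems show ?case by cases auto
next
  case (Add r p q R m)
  from Add.prems show ?case by cases auto
next
  case (Sub r p q R m)
  from Sub.prems show ?case by cases auto
next
  case (Load r p R m)
  from Load.prems show ?case by cases auto
next
  case (Store p q R m)
  from Store.prems show ?case by cases auto
next
  case (Seq c s t s' d t' s'')
  from Seq.prems show ?case
    by cases (metis Seq.IH)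
next
  case (IfZero_True R r c m t s' d)
  from IfZero_True.prems show ?case
    by cases (metis IfZero_True.hyps(1) IfZero_True.IH)+
next
  case (IfZero_False R r d m t s' c)
  from IfZero_False.prems show ?case
    by cases (metis IfZero_False.hyps(1) IfZero_False.IH)+
next
  case (While_End R r c m)
  from While_End.prems show ?case
    by cases (use While_End.hyps in simp_all)
next
  case (While_Step R r c m t s' t' s'')
  from While_Step.prems show ?case
    by cases (metis While_Step.hyps(1) While_Step.IH)+
qed

definition computable :: "(nat \<Rightarrow> nat) \<Rightarrow> bool" where
  "computable f \<longleftrightarrow>
     (\<exists>c. \<forall>n. \<exists>t s. exec c ((\<lambda>_. 0)(0 := n), \<lambda>_. 0) t s \<and> fst s 0 = f n)"

text \<open>
  A bit string is presented one bit per memory cell, with its length in register 0.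
\<close>

definition input_state :: "bool list \<Rightarrow> state" where
  "input_state w =
     ((\<lambda>_. 0)(0 := length w), \<lambda>i. if i < length w \<and> w ! i then 1 else 0)"

definition answers_within :: "com \<Rightarrow> bool list \<Rightarrow> nat \<Rightarrow> bool \<Rightarrow> bool" where
  "answers_within c w T b \<longleftrightarrow>
     (\<exists>t s. exec c (input_state w) t s \<and> t \<le> T \<and> fst s 0 = (if b then 1 else 0))"


section \<open>Fixed-parameter tractability\<close>

text \<open>
  A parameterized decision problem is given by its set of instances, the encoding of
  instances as bit strings, the parameter, and the predicate that singles out the
  yes-instances. Programs are only required to be correct on encodings of instances. The
  time bound is \<open>f (\<kappa> x) * (n + 1) ^ d\<close>, where \<open>n\<close> is the length of the encoding; the
  summand 1 only matters for the empty string.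
\<close>

definition fpt :: "'i set \<Rightarrow> ('i \<Rightarrow> bool list) \<Rightarrow> ('i \<Rightarrow> nat) \<Rightarrow> ('i \<Rightarrow> bool) \<Rightarrow> bool" where
  "fpt I enc \<kappa> Q \<longleftrightarrow>
     (\<exists>c f d. computable f \<and>
        (\<forall>x \<in> I. answers_within c (enc x) (f (\<kappa> x) * Suc (length (enc x)) ^ d) (Q x)))"


section \<open>Encoding of ordered graphs\<close>

definition vertex_list :: "'a ograph \<Rightarrow> 'a list" where
  "vertex_list G =
     (THE xs. distinct xs \<and> set xs = verts G \<and> sorted_wrt (\<lambda>u v. (u, v) \<in> le G) xs)"

lemma vertex_list_exists:
  assumes lin: "linear_order_on A r" and "finite B" "B \<subseteq> A"
  shows "\<exists>xs. distinct xs \<and> set xs = B \<and> sorted_wrt (\<lambda>u v. (u, v) \<in> r) xs"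
  using assms(2,3)
proof (induction B rule: finite_induct)
  case empty
  show ?case by auto
next
  case (insert x B)
  then obtain xs where xs: "distinct xs" "set xs = B" "sorted_wrt (\<lambda>u v. (u, v) \<in> r) xs"
    by auto
  have trans: "trans r" and tot: "total_on A r"
    using lin by (auto simp: order_on_defs)
  let ?ys = "filter (\<lambda>u. (u, x) \<in> r) xs @ x # filter (\<lambda>u. (u, x) \<notin> r) xs"
  have above: "(x, u) \<in> r" if "u \<in> B" "(u, x) \<notin> r" for u
  proof -
    have "x \<in> A" "u \<in> A" "x \<noteq> u"
      using that(1) insert.hyps(2) insert.prems by auto
    then show ?thesis
      using tot that(2) unfolding total_on_def by metis
  qed
  have "sorted_wrt (\<lambda>u v. (u, v) \<in> r) ?ys"
    using xs above transD[OF trans, of _ x]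
    by (simp add: sorted_wrt_append sorted_wrt_filter)
  moreover have "distinct ?ys" "set ?ys = insert x B"
    using xs insert.hyps by auto
  ultimately show ?case by blast
qed

lemma vertex_list_unique:
  assumes "antisym r"
  shows "\<lbrakk>distinct xs; distinct ys; set xs = set ys; sorted_wrt (\<lambda>u v. (u, v) \<in> r) xs;
    sorted_wrt (\<lambda>u v. (u, v) \<in> r) ys\<rbrakk> \<Longrightarrow> xs = ys"
proof (induction xs arbitrary: ys)
  case Nil
  then show ?case by simp
next
  case (Cons x xs)
  then obtain y zs where ys: "ys = y # zs" by (cases ys) auto
  have "x = y"
  proof (rule ccontr)
    assume "x \<noteq> y"
    then have "x \<in> set zs" "y \<in> set xs" using Cons.prems ys by auto
    then have "(y, x) \<in> r" "(x, y) \<in> r" using Cons.prems ys by auto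
    then show False using assms \<open>x \<noteq> y\<close> by (auto dest: antisymD)
  qed
  moreover have "set xs = set zs"
    using Cons.prems ys \<open>x = y\<close> by (auto simp: insert_ident)
  moreover have "xs = zs"
    using Cons.prems ys \<open>set xs = set zs\<close> by (intro Cons.IH) simp_all
  ultimately show ?case using ys by simp
qed

lemma vertex_list:
  assumes "ordered_graph G"
  shows "distinct (vertex_list G)" "set (vertex_list G) = verts G"
    "sorted_wrt (\<lambda>u v. (u, v) \<in> le G) (vertex_list G)"
proof -
  have lin: "linear_order_on (verts G) (le G)" and fin: "finite (verts G)"
    using assms by (auto simp: ordered_graph_def)
  have anti: "antisym (le G)"
    using lin by (auto simp: order_on_defs)
  have "\<exists>!xs. distinct xs \<and> set xs = verts G \<and> sorted_wrt (\<lambda>u v. (u, v) \<in> le G) xs"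
    using vertex_list_exists[OF lin fin subset_refl]
    by (elim ex_ex1I) (auto intro: vertex_list_unique[OF anti])
  from theI'[OF this, folded vertex_list_def]
  show "distinct (vertex_list G)" "set (vertex_list G) = verts G"
    "sorted_wrt (\<lambda>u v. (u, v) \<in> le G) (vertex_list G)" by blast+
qed

text \<open>
  The number of vertices in unary, terminated by a zero, followed by the adjacency matrix
  row by row, with rows and columns in the order of the graph:
\<close>

definition encode_ograph :: "'a ograph \<Rightarrow> bool list" where
  "encode_ograph G =
     (let xs = vertex_list G in
      replicate (length xs) True @ [False] @
      concat (map (\<lambda>u. map (\<lambda>v. {u, v} \<in> edges G) xs) xs))"

definition encode_pair :: "'a ograph \<times> 'b ograph \<Rightarrow> bool list" where
  "encode_pair = (\<lambda>(G, M). encode_ograph G @ encode_ograph M)"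

end

theory Submission
  imports Defs
begin

text \<open>
  A matching has no paths of length two, so the image of one vertex of \<open>G\<close> forces the images
  of its neighbours, and by monotonicity it forces the images of all vertices between two
  vertices with the same image. A partial map closed under both rules and violating no
  constraint can be extended greedily. Let \<open>u\<close> be an unmapped end of an edge and let \<open>a\<close> be
  a vertex of \<open>M\<close> that is already in use. If mapping \<open>u\<close> to \<open>a\<close> and propagating leads to no
  conflict, then this is safe: any homomorphism extending the old partial map may be
  overwritten by the new one. If no \<open>a\<close> in use works, then \<open>u\<close> needs an image not used so
  far. This happens at most \<open>k = |V(M)|\<close> times, so trying all choices costs a factor
  \<open>k ^ k \<le> 2 ^ (k * k)\<close>. Isolated vertices of \<open>G\<close> can be mapped at the end.

  The algorithm is written in a language of bounded loops with a total semantics. A syntactic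
  condition (no loop changes its own bound) makes the running time of a compiled program
  polynomial in the largest loop bound.
\<close>

section \<open>Bounded loops on the random access machine\<close>

text \<open>The loop language has no branching computation paths, so the choices of new images
  become an outer loop over numbers \<open>c\<close>, whose base \<open>k\<close> digits are the
  guesses. The range \<open>2 ^ (k * k)\<close> replaces \<open>k ^ k\<close> because it arises by
  repeated doubling on a machine that cannot multiply; the same doubling program shows that the
  final time bound is computable.

  Reusing an image is safe only if propagation stays within the images in use: then each of them
  occurs at a vertex whose image was fixed before. The set of images in use must therefore be closed
  under partners. This is why the search only looks at ends of edges: a neighbour is then forced to
  carry the partner.

  The loop bounds \<open>n\<close> and \<open>k\<close> are themselves decoded from the input, so
  the whole program violates the syntactic condition. It is cut into phases that satisfy it one by
  one. All loop bounds are at most \<open>(length w + 1) * 2 ^ (k * k)\<close>, and a power of this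
  product splits into a function of \<open>k\<close> and a power of the input length.\<close>

datatype arr = Col | Tmp | Partner

fun arr_index :: "arr \<Rightarrow> nat" where
  "arr_index Col = 0"
| "arr_index Tmp = 1"
| "arr_index Partner = 2"

datatype exp =
    Num nat
  | Len
  | Reg nat
  | Plus exp exp
  | Minus exp exp
  | Input exp
  | Cell arr exp

datatype prog =
    Skip
  | Assign nat exp
  | Write arr exp exp
  | Then prog prog (infixr ";;" 60)
  | Cond exp prog prog
  | For nat nat prog

type_synonym env = "(nat \<Rightarrow> nat) \<times> (arr \<Rightarrow> nat \<Rightarrow> nat)"

definition input_bit :: "bool list \<Rightarrow> nat \<Rightarrow> nat" where
  "input_bit w i = (if i < length w \<and> w ! i then 1 else 0)"

primrec eval :: "bool list \<Rightarrow> exp \<Rightarrow> env \<Rightarrow> nat" where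
  "eval w (Num c) s = c"
| "eval w Len s = length w"
| "eval w (Reg r) s = fst s r"
| "eval w (Plus a b) s = eval w a s + eval w b s"
| "eval w (Minus a b) s = eval w a s - eval w b s"
| "eval w (Input e) s = input_bit w (eval w e s)"
| "eval w (Cell a e) s = snd s a (eval w e s)"

definition set_reg :: "nat \<Rightarrow> nat \<Rightarrow> env \<Rightarrow> env" where
  "set_reg r x s = ((fst s)(r := x), snd s)"

definition set_cell :: "arr \<Rightarrow> nat \<Rightarrow> nat \<Rightarrow> env \<Rightarrow> env" where
  "set_cell a i x s = (fst s, (snd s)(a := (snd s a)(i := x)))"

primrec run :: "bool list \<Rightarrow> prog \<Rightarrow> env \<Rightarrow> env" where
  "run w Skip = (\<lambda>s. s)"
| "run w (Assign r e) = (\<lambda>s. set_reg r (eval w e s) s)"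
| "run w (Write a i e) = (\<lambda>s. set_cell a (eval w i s) (eval w e s) s)"
| "run w (p ;; q) = (\<lambda>s. run w q (run w p s))"
| "run w (Cond e p q) = (\<lambda>s. if eval w e s = 0 then run w q s else run w p s)"
| "run w (For i b p) = (\<lambda>s. fold (\<lambda>j s. run w p (set_reg i j s)) [0..<fst s b] s)"

primrec mods :: "prog \<Rightarrow> nat set" where
  "mods Skip = {}"
| "mods (Assign r e) = {r}"
| "mods (Write a i e) = {}"
| "mods (p ;; q) = mods p \<union> mods q"
| "mods (Cond e p q) = mods p \<union> mods q"
| "mods (For i b p) = insert i (mods p)"

primrec writes :: "prog \<Rightarrow> arr set" where
  "writes Skip = {}"
| "writes (Assign r e) = {}"
| "writes (Write a i e) = {a}"
| "writes (p ;; q) = writes p \<union> writes q"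
| "writes (Cond e p q) = writes p \<union> writes q"
| "writes (For i b p) = writes p"

primrec bounds :: "prog \<Rightarrow> nat set" where
  "bounds Skip = {}"
| "bounds (Assign r e) = {}"
| "bounds (Write a i e) = {}"
| "bounds (p ;; q) = bounds p \<union> bounds q"
| "bounds (Cond e p q) = bounds p \<union> bounds q"
| "bounds (For i b p) = insert b (bounds p)"

section \<open>What a program leaves unchanged\<close>

lemma run_frame: "r \<notin> mods p \<Longrightarrow> fst (run w p s) r = fst s r"
proof (induction p arbitrary: s)
  case (For i b p)
  have "fst (fold (\<lambda>j s. run w p (set_reg i j s)) js s) r = fst s r" for js
    by (induction js arbitrary: s) (use For in \<open>auto simp: set_reg_def\<close>)
  then show ?case by simp
qed (auto simp: set_reg_def set_cell_def)

lemma run_frame_array: "a \<notin> writes p \<Longrightarrow> snd (run w p s) a = snd s a"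
proof (induction p arbitrary: s)
  case (For i b p)
  have "snd (fold (\<lambda>j s. run w p (set_reg i j s)) js s) a = snd s a" for js
    by (induction js arbitrary: s) (use For in \<open>auto simp: set_reg_def\<close>)
  then show ?case by simp
qed (auto simp: set_reg_def set_cell_def)

text \<open>
  In the compiled program register 0 keeps the length of the input; variables live in odd
  registers, temporaries in positive even ones. The three arrays are interleaved behind
  the input.
\<close>

definition var :: "nat \<Rightarrow> nat" where
  "var r = 2 * r + 1"

definition tmp :: "nat \<Rightarrow> nat" where
  "tmp t = 2 * t + 2"

lemma var_tmp [simp]:
  "var r \<noteq> tmp t" "tmp t \<noteq> var r" "var r \<noteq> 0" "tmp t \<noteq> 0" "0 \<noteq> var r" "0 \<noteq> tmp t"
  "var r = var r' \<longleftrightarrow> r = r'" "tmp t = tmp t' \<longleftrightarrow> t = t'"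
  by (auto simp: var_def tmp_def) presburger+

text \<open>The machine cannot multiply, so the index is tripled by two additions. Register 0 holds
  the length of the input and thus the first address behind it; \<open>tmp (t + 1)\<close> is
  scratch.\<close>

definition cell_addr :: "arr \<Rightarrow> nat \<Rightarrow> com" where
  "cell_addr a t =
     Seq (Add (tmp (t + 1)) (tmp t) (tmp t)) (Seq (Add (tmp t) (tmp t) (tmp (t + 1)))
     (Seq (Add (tmp t) (tmp t) 0) (Seq (Const (tmp (t + 1)) (arr_index a))
     (Add (tmp t) (tmp t) (tmp (t + 1))))))"

text \<open>\<open>t\<close> acts as a stack pointer into the temporaries. There is no move
  instruction, so copying is adding to zero. \<open>Input\<close> compares the index with the length
  before loading, because an index behind the input would hit an array cell instead of giving
  0.\<close>

primrec compile_exp :: "exp \<Rightarrow> nat \<Rightarrow> com" where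
  "compile_exp (Num c) t = Const (tmp t) c"
| "compile_exp Len t = Seq (Const (tmp t) 0) (Add (tmp t) (tmp t) 0)"
| "compile_exp (Reg r) t = Seq (Const (tmp t) 0) (Add (tmp t) (tmp t) (var r))"
| "compile_exp (Plus a b) t =
     Seq (compile_exp a t) (Seq (compile_exp b (t + 1)) (Add (tmp t) (tmp t) (tmp (t + 1))))"
| "compile_exp (Minus a b) t =
     Seq (compile_exp a t) (Seq (compile_exp b (t + 1)) (Sub (tmp t) (tmp t) (tmp (t + 1))))"
| "compile_exp (Input e) t =
     Seq (compile_exp e t) (Seq (Sub (tmp (t + 1)) 0 (tmp t))
     (IfZero (tmp (t + 1)) (Const (tmp t) 0) (Load (tmp t) (tmp t))))"
| "compile_exp (Cell a e) t = Seq (compile_exp e t) (Seq (cell_addr a t) (Load (tmp t) (tmp t)))"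

primrec exp_time :: "exp \<Rightarrow> nat" where
  "exp_time (Num c) = 1"
| "exp_time Len = 2"
| "exp_time (Reg r) = 2"
| "exp_time (Plus a b) = exp_time a + exp_time b + 1"
| "exp_time (Minus a b) = exp_time a + exp_time b + 1"
| "exp_time (Input e) = exp_time e + 3"
| "exp_time (Cell a e) = exp_time e + 6"

text \<open>The loop bound is copied once to \<open>tmp t\<close>, which counts down, while
  \<open>tmp (t + 1)\<close> counts up and feeds the loop variable; the body may overwrite that
  variable without disturbing the loop. The body is compiled at \<open>t + 2\<close> and may clobber
  \<open>tmp (t + 2)\<close>, so this scratch register is reloaded afterwards.\<close>

primrec compile :: "prog \<Rightarrow> nat \<Rightarrow> com" where
  "compile Skip t = Const (tmp t) 0"
| "compile (Assign r e) t =
     Seq (compile_exp e t) (Seq (Const (tmp (t + 1)) 0) (Add (var r) (tmp t) (tmp (t + 1))))"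
| "compile (Write a i e) t =
     Seq (compile_exp i t) (Seq (cell_addr a t) (Seq (compile_exp e (t + 1)) (Store (tmp t) (tmp (t + 1)))))"
| "compile (p ;; q) t = Seq (compile p t) (compile q t)"
| "compile (Cond e p q) t = Seq (compile_exp e t) (IfZero (tmp t) (compile q t) (compile p t))"
| "compile (For i b p) t =
     Seq (Const (tmp (t + 1)) 0) (Seq (Const (tmp (t + 2)) 0)
     (Seq (Add (tmp t) (var b) (tmp (t + 2)))
     (WhileNonzero (tmp t)
       (Seq (Const (tmp (t + 2)) 0) (Seq (Add (var i) (tmp (t + 1)) (tmp (t + 2)))
       (Seq (compile p (t + 2))
       (Seq (Const (tmp (t + 2)) 1) (Seq (Add (tmp (t + 1)) (tmp (t + 1)) (tmp (t + 2)))
       (Sub (tmp t) (tmp t) (tmp (t + 2)))))))))))"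

text \<open>A loop pays three instructions of setup and a final test; each iteration adds one test
  and five instructions to the body. Branches are summed, which avoids maxima in the polynomial
  bound.\<close>

primrec cost :: "prog \<Rightarrow> nat \<Rightarrow> nat" where
  "cost Skip B = 1"
| "cost (Assign r e) B = exp_time e + 2"
| "cost (Write a i e) B = exp_time i + exp_time e + 6"
| "cost (p ;; q) B = cost p B + cost q B"
| "cost (Cond e p q) B = exp_time e + 1 + cost p B + cost q B"
| "cost (For i b p) B = 4 + B * (6 + cost p B)"

definition represents :: "bool list \<Rightarrow> env \<Rightarrow> state \<Rightarrow> bool" where
  "represents w s x \<longleftrightarrow>
     fst x 0 = length w \<and> (\<forall>r. fst x (var r) = fst s r) \<and>
     (\<forall>i < length w. snd x i = input_bit w i) \<and>
     (\<forall>a i. snd x (length w + 3 * i + arr_index a) = snd s a i)"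

text \<open>Residues modulo 3 separate the arrays, so a write reaches exactly one cell of one
  array.\<close>

lemma arr_address_inj: "3 * i + arr_index a = 3 * i' + arr_index a' \<longleftrightarrow> i = i' \<and> a = a'"
  by (cases a; cases a'; simp; presburger)

lemmas exec_simple = exec.Const exec.Add exec.Sub exec.Load exec.Store

text \<open>The rules of \<open>exec\<close> build the running time as a nested sum. This lemma
  exchanges the sum for the wanted expression and leaves the claims about the final registers as a
  separate goal.\<close>

lemma exec_witness:
  "exec c x T (R', m) \<Longrightarrow> T = T' \<Longrightarrow> P R' \<Longrightarrow> \<exists>R'. exec c x T' (R', m) \<and> P R'"
  by blast

lemma exec_cell_addr:
  "\<exists>R'. exec (cell_addr a t) (R, m) 5 (R', m) \<and> R' (tmp t) = R 0 + 3 * R (tmp t) + arr_index a \<and>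
     (\<forall>r. r \<noteq> tmp t \<and> r \<noteq> tmp (t + 1) \<longrightarrow> R' r = R r)"
proof -
  let ?R1 = "R(tmp (t + 1) := R (tmp t) + R (tmp t))"
  let ?R2 = "?R1(tmp t := ?R1 (tmp t) + ?R1 (tmp (t + 1)))"
  let ?R3 = "?R2(tmp t := ?R2 (tmp t) + ?R2 0)"
  let ?R4 = "?R3(tmp (t + 1) := arr_index a)"
  let ?R5 = "?R4(tmp t := ?R4 (tmp t) + ?R4 (tmp (t + 1)))"
  have "exec (cell_addr a t) (R, m) (1 + (1 + (1 + (1 + 1)))) (?R5, m)"
    unfolding cell_addr_def by (rule exec.Seq exec_simple)+
  then show ?thesis by (rule exec_witness) auto
qed

text \<open>Variables and the temporaries below \<open>t\<close> survive. So the first operand can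
  wait in \<open>tmp t\<close> while the second one is computed from \<open>t + 1\<close> upwards,
  and the state still represents \<open>s\<close>.\<close>

lemma exec_comp_exp:
  assumes "represents w s (R, m)"
  shows "\<exists>R'. exec (compile_exp e t) (R, m) (exp_time e) (R', m) \<and> R' (tmp t) = eval w e s \<and>
    (\<forall>r. (\<forall>j \<ge> t. r \<noteq> tmp j) \<longrightarrow> R' r = R r)"
  using assms
proof (induction e arbitrary: t R)
  case (Num c)
  show ?case unfolding compile_exp.simps by (rule exec_witness[OF exec.Const]) auto
next
  case Len
  let ?R1 = "R(tmp t := 0)"
  let ?R2 = "?R1(tmp t := ?R1 (tmp t) + ?R1 0)"
  have "exec (compile_exp Len t) (R, m) (1 + 1) (?R2, m)"
    unfolding compile_exp.simps by (rule exec.Seq exec_simple)+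
  then show ?case by (rule exec_witness) (use Len in \<open>auto simp: represents_def\<close>)
next
  case (Reg r)
  let ?R1 = "R(tmp t := 0)"
  let ?R2 = "?R1(tmp t := ?R1 (tmp t) + ?R1 (var r))"
  have "exec (compile_exp (Reg r) t) (R, m) (1 + 1) (?R2, m)"
    unfolding compile_exp.simps by (rule exec.Seq exec_simple)+
  then show ?case by (rule exec_witness) (use Reg in \<open>auto simp: represents_def\<close>)
next
  case (Plus a b)
  from Plus.IH(1)[OF Plus.prems, of t] obtain R1 where
    1: "exec (compile_exp a t) (R, m) (exp_time a) (R1, m)" "R1 (tmp t) = eval w a s"
      "\<And>r. (\<forall>j \<ge> t. r \<noteq> tmp j) \<Longrightarrow> R1 r = R r" by blast
  have "represents w s (R1, m)" using Plus.prems 1(3) by (auto simp: represents_def)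
  from Plus.IH(2)[OF this, of "t + 1"] obtain R2 where
    2: "exec (compile_exp b (t + 1)) (R1, m) (exp_time b) (R2, m)" "R2 (tmp (t + 1)) = eval w b s"
      "\<And>r. (\<forall>j \<ge> t + 1. r \<noteq> tmp j) \<Longrightarrow> R2 r = R1 r" by blast
  let ?R3 = "R2(tmp t := R2 (tmp t) + R2 (tmp (t + 1)))"
  have "exec (compile_exp (Plus a b) t) (R, m) (exp_time a + (exp_time b + 1)) (?R3, m)"
    unfolding compile_exp.simps by (rule exec.Seq 1(1) 2(1) exec_simple)+
  then show ?case by (rule exec_witness) (use 1 2 in auto)
next
  case (Minus a b)
  from Minus.IH(1)[OF Minus.prems, of t] obtain R1 where
    1: "exec (compile_exp a t) (R, m) (exp_time a) (R1, m)" "R1 (tmp t) = eval w a s"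
      "\<And>r. (\<forall>j \<ge> t. r \<noteq> tmp j) \<Longrightarrow> R1 r = R r" by blast
  have "represents w s (R1, m)" using Minus.prems 1(3) by (auto simp: represents_def)
  from Minus.IH(2)[OF this, of "t + 1"] obtain R2 where
    2: "exec (compile_exp b (t + 1)) (R1, m) (exp_time b) (R2, m)" "R2 (tmp (t + 1)) = eval w b s"
      "\<And>r. (\<forall>j \<ge> t + 1. r \<noteq> tmp j) \<Longrightarrow> R2 r = R1 r" by blast
  let ?R3 = "R2(tmp t := R2 (tmp t) - R2 (tmp (t + 1)))"
  have "exec (compile_exp (Minus a b) t) (R, m) (exp_time a + (exp_time b + 1)) (?R3, m)"
    unfolding compile_exp.simps by (rule exec.Seq 1(1) 2(1) exec_simple)+
  then show ?case by (rule exec_witness) (use 1 2 in auto)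
next
  case (Input e)
  from Input.IH[OF Input.prems, of t] obtain R1 where
    1: "exec (compile_exp e t) (R, m) (exp_time e) (R1, m)" "R1 (tmp t) = eval w e s"
      "\<And>r. (\<forall>j \<ge> t. r \<noteq> tmp j) \<Longrightarrow> R1 r = R r" by blast
  let ?R2 = "R1(tmp (t + 1) := R1 0 - R1 (tmp t))"
  have len: "R1 0 = length w" using Input.prems 1(3)[of 0] by (simp add: represents_def)
  have "exec (IfZero (tmp (t + 1)) (Const (tmp t) 0) (Load (tmp t) (tmp t))) (?R2, m) (Suc 1)
      (?R2(tmp t := eval w (Input e) s), m)"
  proof (cases "eval w e s < length w")
    case True
    then have "m (?R2 (tmp t)) = eval w (Input e) s"
      using Input.prems 1(2) by (simp add: represents_def)
    moreover have "exec (IfZero (tmp (t + 1)) (Const (tmp t) 0) (Load (tmp t) (tmp t))) (?R2, m) (Suc 1)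
        (?R2(tmp t := m (?R2 (tmp t))), m)"
      using True len 1(2) by (intro exec.IfZero_False exec.Load) simp
    ultimately show ?thesis by simp
  next
    case False
    then show ?thesis
      using exec.IfZero_True[where R = ?R2 and r = "tmp (t + 1)", OF _ exec.Const] len 1(2)
      by (simp add: input_bit_def)
  qed
  note 2 = this
  let ?R3 = "?R2(tmp t := eval w (Input e) s)"
  have "exec (compile_exp (Input e) t) (R, m) (exp_time e + (1 + Suc 1)) (?R3, m)"
    unfolding compile_exp.simps by (rule exec.Seq 1(1) exec.Sub 2)+
  then show ?case by (rule exec_witness) (use 1 in auto)
next
  case (Cell a e)
  from Cell.IH[OF Cell.prems, of t] obtain R1 where
    1: "exec (compile_exp e t) (R, m) (exp_time e) (R1, m)" "R1 (tmp t) = eval w e s"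
      "\<And>r. (\<forall>j \<ge> t. r \<noteq> tmp j) \<Longrightarrow> R1 r = R r" by blast
  from exec_cell_addr[of a t R1 m] obtain R2 where
    2: "exec (cell_addr a t) (R1, m) 5 (R2, m)" "R2 (tmp t) = R1 0 + 3 * R1 (tmp t) + arr_index a"
      "\<And>r. r \<noteq> tmp t \<and> r \<noteq> tmp (t + 1) \<Longrightarrow> R2 r = R1 r" by blast
  let ?R3 = "R2(tmp t := m (R2 (tmp t)))"
  have "exec (compile_exp (Cell a e) t) (R, m) (exp_time e + (5 + 1)) (?R3, m)"
    unfolding compile_exp.simps by (rule exec.Seq 1(1) 2(1) exec_simple)+
  note 3 = this
  have "m (R2 (tmp t)) = snd s a (eval w e s)"
    using Cell.prems 1(2) 1(3)[of 0] 2(2) by (auto simp: represents_def)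
  then show ?case by (intro exec_witness[OF 3]) (use 1 2 in auto)
qed

section \<open>Running time of compiled programs\<close>

definition takes :: "bool list \<Rightarrow> prog \<Rightarrow> env \<Rightarrow> nat \<Rightarrow> bool" where
  "takes w p s T \<longleftrightarrow>
     (\<forall>t R m. represents w s (R, m) \<longrightarrow>
        (\<exists>T' R' m'. exec (compile p t) (R, m) T' (R', m') \<and> T' \<le> T \<and>
           represents w (run w p s) (R', m') \<and> (\<forall>j < t. R' (tmp j) = R (tmp j))))"

lemma takesE:
  assumes "takes w p s T" "represents w s (R, m)"
  obtains T' R' m' where "exec (compile p t) (R, m) T' (R', m')" "T' \<le> T"
    "represents w (run w p s) (R', m')" "\<And>j. j < t \<Longrightarrow> R' (tmp j) = R (tmp j)"
  using assms unfolding takes_def by blast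

lemma takes_Then:
  assumes "takes w p s T" "takes w q (run w p s) T'"
  shows "takes w (p ;; q) s (T + T')"
  unfolding takes_def
proof (intro allI impI)
  fix t R m assume "represents w s (R, m)"
  from takesE[OF assms(1) this, of t] obtain T1 R1 m1 where
    1: "exec (compile p t) (R, m) T1 (R1, m1)" "T1 \<le> T"
      "represents w (run w p s) (R1, m1)" "\<And>j. j < t \<Longrightarrow> R1 (tmp j) = R (tmp j)" by blast
  from takesE[OF assms(2) 1(3), of t] obtain T2 R2 m2 where
    2: "exec (compile q t) (R1, m1) T2 (R2, m2)" "T2 \<le> T'"
      "represents w (run w q (run w p s)) (R2, m2)" "\<And>j. j < t \<Longrightarrow> R2 (tmp j) = R1 (tmp j)" by blast
  have "exec (compile (p ;; q) t) (R, m) (T1 + T2) (R2, m2)"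
    unfolding compile.simps using 1(1) 2(1) by (rule exec.Seq)
  with 1 2 show "\<exists>T'' R' m'. exec (compile (p ;; q) t) (R, m) T'' (R', m') \<and> T'' \<le> T + T' \<and>
      represents w (run w (p ;; q) s) (R', m') \<and> (\<forall>j < t. R' (tmp j) = R (tmp j))"
    by (intro exI conjI) (assumption, simp_all)
qed

text \<open>\<open>B\<close> bounds the registers in \<open>bounds p\<close> only in the initial
  state. Since \<open>p\<close> modifies none of them, \<open>run_frame\<close> carries the bound to
  every later point where an inner loop is entered.\<close>

lemma takes_loops:
  assumes "bounds p \<inter> mods p = {}" "\<And>b. b \<in> bounds p \<Longrightarrow> fst s b \<le> B"
  shows "takes w p s (cost p B)"
  using assms
proof (induction p arbitrary: s)
  case Skip
  show ?case unfolding takes_def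
  proof (intro allI impI)
    fix t R m assume rep: "represents w s (R, m)"
    show "\<exists>T R' m'. exec (compile Skip t) (R, m) T (R', m') \<and> T \<le> cost Skip B \<and>
        represents w (run w Skip s) (R', m') \<and> (\<forall>j < t. R' (tmp j) = R (tmp j))"
      unfolding compile.simps
      by (intro exI conjI, rule exec.Const) (use rep in \<open>auto simp: represents_def\<close>)
  qed
next
  case (Assign r e)
  show ?case unfolding takes_def
  proof (intro allI impI)
    fix t R m assume rep: "represents w s (R, m)"
    from exec_comp_exp[OF this, of e t] obtain R1 where
      1: "exec (compile_exp e t) (R, m) (exp_time e) (R1, m)" "R1 (tmp t) = eval w e s"
        "\<And>r. (\<forall>j \<ge> t. r \<noteq> tmp j) \<Longrightarrow> R1 r = R r" by blast
    let ?R2 = "R1(tmp (t + 1) := 0)"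
    let ?R3 = "?R2(var r := ?R2 (tmp t) + ?R2 (tmp (t + 1)))"
    have "exec (compile (Assign r e) t) (R, m) (exp_time e + (1 + 1)) (?R3, m)"
      unfolding compile.simps by (rule exec.Seq 1(1) exec_simple)+
    then show "\<exists>T R' m'. exec (compile (Assign r e) t) (R, m) T (R', m') \<and> T \<le> cost (Assign r e) B \<and>
        represents w (run w (Assign r e) s) (R', m') \<and> (\<forall>j < t. R' (tmp j) = R (tmp j))"
      using 1 rep by (intro exI conjI) (assumption, auto simp: represents_def set_reg_def)
  qed
next
  case (Write a i e)
  show ?case unfolding takes_def
  proof (intro allI impI)
    fix t R m assume rep: "represents w s (R, m)"
    from exec_comp_exp[OF this, of i t] obtain R1 where
      1: "exec (compile_exp i t) (R, m) (exp_time i) (R1, m)" "R1 (tmp t) = eval w i s"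
        "\<And>r. (\<forall>j \<ge> t. r \<noteq> tmp j) \<Longrightarrow> R1 r = R r" by blast
    from exec_cell_addr[of a t R1 m] obtain R2 where
      2: "exec (cell_addr a t) (R1, m) 5 (R2, m)" "R2 (tmp t) = R1 0 + 3 * R1 (tmp t) + arr_index a"
        "\<And>r. r \<noteq> tmp t \<and> r \<noteq> tmp (t + 1) \<Longrightarrow> R2 r = R1 r" by blast
    have "represents w s (R2, m)" using rep 1(3) 2(3) by (auto simp: represents_def)
    from exec_comp_exp[OF this, of e "t + 1"] obtain R3 where
      3: "exec (compile_exp e (t + 1)) (R2, m) (exp_time e) (R3, m)" "R3 (tmp (t + 1)) = eval w e s"
        "\<And>r. (\<forall>j \<ge> t + 1. r \<noteq> tmp j) \<Longrightarrow> R3 r = R2 r" by blast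
    have addr: "R3 (tmp t) = length w + (3 * eval w i s + arr_index a)"
      using rep 1(2) 1(3)[of 0] 2(2) 3(3)[of "tmp t"] by (simp add: represents_def)
    have "exec (compile (Write a i e) t) (R, m) (exp_time i + (5 + (exp_time e + 1)))
        (R3, m(R3 (tmp t) := R3 (tmp (t + 1))))"
      unfolding compile.simps by (rule exec.Seq 1(1) 2(1) 3(1) exec_simple)+
    then show "\<exists>T R' m'. exec (compile (Write a i e) t) (R, m) T (R', m') \<and> T \<le> cost (Write a i e) B \<and>
        represents w (run w (Write a i e) s) (R', m') \<and> (\<forall>j < t. R' (tmp j) = R (tmp j))"
      using 1 2 3 addr rep
      by (intro exI conjI)
        (assumption, auto simp: represents_def set_cell_def add.assoc arr_address_inj)
  qed
next
  case (Then p q)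
  have "takes w q (run w p s) (cost q B)"
    using Then.prems by (intro Then.IH) (auto simp: run_frame disjoint_iff)
  moreover have "takes w p s (cost p B)"
    using Then.prems by (intro Then.IH) auto
  ultimately show ?case by (simp add: takes_Then)
next
  case (Cond e p q)
  show ?case unfolding takes_def
  proof (intro allI impI)
    fix t R m assume rep: "represents w s (R, m)"
    from exec_comp_exp[OF this, of e t] obtain R1 where
      1: "exec (compile_exp e t) (R, m) (exp_time e) (R1, m)" "R1 (tmp t) = eval w e s"
        "\<And>r. (\<forall>j \<ge> t. r \<noteq> tmp j) \<Longrightarrow> R1 r = R r" by blast
    have rep1: "represents w s (R1, m)" using rep 1(3) by (auto simp: represents_def)
    have tp: "takes w p s (cost p B)" and tq: "takes w q s (cost q B)"
      using Cond.prems by (intro Cond.IH; auto)+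
    have "\<exists>T R' m'. exec (IfZero (tmp t) (compile q t) (compile p t)) (R1, m) (Suc T) (R', m') \<and>
        T \<le> cost p B + cost q B \<and> represents w (run w (Cond e p q) s) (R', m') \<and>
        (\<forall>j < t. R' (tmp j) = R1 (tmp j))"
    proof (cases "eval w e s = 0")
      case True
      from takesE[OF tq rep1, of t] show ?thesis
        by (metis (no_types, lifting) 1(2) True exec.IfZero_True run.simps(5) trans_le_add2)
    next
      case False
      from takesE[OF tp rep1, of t] show ?thesis
        by (metis (no_types, lifting) 1(2) False exec.IfZero_False run.simps(5) trans_le_add1)
    qed
    then obtain T2 R2 m2 where 2: "exec (IfZero (tmp t) (compile q t) (compile p t)) (R1, m) (Suc T2) (R2, m2)"
      "T2 \<le> cost p B + cost q B" "represents w (run w (Cond e p q) s) (R2, m2)"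
      "\<And>j. j < t \<Longrightarrow> R2 (tmp j) = R1 (tmp j)" by blast
    have "exec (compile (Cond e p q) t) (R, m) (exp_time e + Suc T2) (R2, m2)"
      unfolding compile.simps using 1(1) 2(1) by (rule exec.Seq)
    then show "\<exists>T R' m'. exec (compile (Cond e p q) t) (R, m) T (R', m') \<and> T \<le> cost (Cond e p q) B \<and>
        represents w (run w (Cond e p q) s) (R', m') \<and> (\<forall>j < t. R' (tmp j) = R (tmp j))"
      using 1 2 by (intro exI conjI) (assumption, auto)
  qed
next
  case (For i b p)
  show ?case unfolding takes_def
  proof (intro allI impI)
    fix t R m assume rep: "represents w s (R, m)"
    let ?N = "fst s b"
    let ?st = "\<lambda>j s. run w p (set_reg i j s)"
    define body where "body = Seq (Const (tmp (t + 2)) 0) (Seq (Add (var i) (tmp (t + 1)) (tmp (t + 2)))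
       (Seq (compile p (t + 2))
       (Seq (Const (tmp (t + 2)) 1) (Seq (Add (tmp (t + 1)) (tmp (t + 1)) (tmp (t + 2)))
       (Sub (tmp t) (tmp t) (tmp (t + 2)))))))"
    \<comment> \<open>\<open>d\<close> is the number of iterations left and \<open>j\<close> the
      next index; \<open>Suc\<close> pays for the test that ends the loop.\<close>
    have loop: "\<exists>T R' m'. exec (WhileNonzero (tmp t) body) (R1, m1) (Suc T) (R', m') \<and>
        T \<le> d * (6 + cost p B) \<and> represents w (fold ?st [j..<j + d] s1) (R', m') \<and>
        (\<forall>j < t. R' (tmp j) = R1 (tmp j))"
      if "represents w s1 (R1, m1)" "R1 (tmp t) = d" "R1 (tmp (t + 1)) = j"
        "\<And>b. b \<in> bounds p \<Longrightarrow> fst s1 b \<le> B" for d j s1 R1 m1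
      using that
    proof (induction d arbitrary: j s1 R1 m1)
      case 0
      have "exec (WhileNonzero (tmp t) body) (R1, m1) (Suc 0) (R1, m1)"
        using exec.While_End[of R1 "tmp t"] 0 by simp
      with 0 show ?case by (intro exI conjI) (assumption, auto)
    next
      case (Suc d)
      let ?R2 = "R1(tmp (t + 2) := 0)"
      let ?R3 = "?R2(var i := ?R2 (tmp (t + 1)) + ?R2 (tmp (t + 2)))"
      have rep3: "represents w (set_reg i j s1) (?R3, m1)"
        using Suc.prems by (auto simp: represents_def set_reg_def)
      have "takes w p (set_reg i j s1) (cost p B)"
        using For.prems Suc.prems by (intro For.IH) (auto simp: set_reg_def disjoint_iff)
      from takesE[OF this rep3, of "t + 2"] obtain T4 R4 m4 where
        4: "exec (compile p (t + 2)) (?R3, m1) T4 (R4, m4)" "T4 \<le> cost p B"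
          "represents w (?st j s1) (R4, m4)" "\<And>l. l < t + 2 \<Longrightarrow> R4 (tmp l) = ?R3 (tmp l)" by metis
      let ?R5 = "R4(tmp (t + 2) := 1)"
      let ?R6 = "?R5(tmp (t + 1) := ?R5 (tmp (t + 1)) + ?R5 (tmp (t + 2)))"
      let ?R7 = "?R6(tmp t := ?R6 (tmp t) - ?R6 (tmp (t + 2)))"
      have body: "exec body (R1, m1) (1 + (1 + (T4 + (1 + (1 + 1))))) (?R7, m4)"
        unfolding body_def by (rule exec.Seq 4(1) exec_simple)+
      have rep7: "represents w (?st j s1) (?R7, m4)"
        using 4(3) by (auto simp: represents_def)
      have vals: "R4 (tmp t) = Suc d" "R4 (tmp (t + 1)) = j"
        using 4(4)[of t] 4(4)[of "t + 1"] Suc.prems by simp_all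
      have vals': "?R7 (tmp t) = d" "?R7 (tmp (t + 1)) = Suc j"
        using vals by simp_all
      have "fst (?st j s1) b \<le> B" if "b \<in> bounds p" for b
        using that For.prems Suc.prems by (subst run_frame) (auto simp: set_reg_def disjoint_iff)
      from Suc.IH[OF rep7 vals' this] obtain T R' m' where
        r: "exec (WhileNonzero (tmp t) body) (?R7, m4) (Suc T) (R', m')"
        "T \<le> d * (6 + cost p B)" "represents w (fold ?st [Suc j..<Suc j + d] (?st j s1)) (R', m')"
        "\<And>l. l < t \<Longrightarrow> R' (tmp l) = ?R7 (tmp l)" by blast
      have "exec (WhileNonzero (tmp t) body) (R1, m1)
          (Suc ((1 + (1 + (T4 + (1 + (1 + 1))))) + Suc T)) (R', m')"
        using Suc.prems(2) body r(1) by (intro exec.While_Step) simp_all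
      moreover have "fold ?st [j..<j + Suc d] s1 = fold ?st [Suc j..<Suc j + d] (?st j s1)"
        by (subst upt_conv_Cons) simp_all
      ultimately show ?case using r 4
        by (intro exI conjI) (assumption, auto)
    qed
    let ?R1 = "R(tmp (t + 1) := 0)"
    let ?R2 = "?R1(tmp (t + 2) := 0)"
    let ?R3 = "?R2(tmp t := ?R2 (var b) + ?R2 (tmp (t + 2)))"
    have rep3: "represents w s (?R3, m)" using rep by (auto simp: represents_def)
    have "?R3 (tmp t) = ?N" using rep by (auto simp: represents_def)
    moreover have "?R3 (tmp (t + 1)) = 0" by simp
    moreover have "fst s b' \<le> B" if "b' \<in> bounds p" for b' using that For.prems by simp
    ultimately obtain T R' m' where
      l: "exec (WhileNonzero (tmp t) body) (?R3, m) (Suc T) (R', m')"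
      "T \<le> ?N * (6 + cost p B)" "represents w (fold ?st [0..<?N] s) (R', m')"
      "\<And>j. j < t \<Longrightarrow> R' (tmp j) = ?R3 (tmp j)"
      using loop[OF rep3, of ?N 0] unfolding add_0 by blast
    have "exec (compile (For i b p) t) (R, m) (1 + (1 + (1 + Suc T))) (R', m')"
      unfolding compile.simps body_def[symmetric] by (rule exec.Seq exec_simple l(1))+
    moreover have "T \<le> B * (6 + cost p B)"
      using For.prems(2)[of b] by (intro order_trans[OF l(2)] mult_le_mono1) simp
    ultimately show "\<exists>T R' m'. exec (compile (For i b p) t) (R, m) T (R', m') \<and>
        T \<le> cost (For i b p) B \<and> represents w (run w (For i b p) s) (R', m') \<and>
        (\<forall>j < t. R' (tmp j) = R (tmp j))"
      using l by (intro exI conjI) (assumption, auto)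
  qed
qed

text \<open>Each loop raises the degree by one. For sequences and branches the degrees are added, so
  that one exponent dominates both parts.\<close>

lemma cost_polynomial: "\<exists>C D. \<forall>B. cost p B \<le> C * Suc B ^ D"
proof (induction p)
  case Skip
  show ?case by (intro exI[of _ 1] exI[of _ 0]) simp
next
  case (Assign r e)
  show ?case by (intro exI[of _ "exp_time e + 2"] exI[of _ 0]) simp
next
  case (Write a i e)
  show ?case by (intro exI[of _ "exp_time i + exp_time e + 6"] exI[of _ 0]) simp
next
  case (Then p q)
  then obtain C D C' D' where *: "\<And>B. cost p B \<le> C * Suc B ^ D" "\<And>B. cost q B \<le> C' * Suc B ^ D'"
    by blast
  have "cost (p ;; q) B \<le> (C + C') * Suc B ^ (D + D')" for B
  proof -
    have "C * Suc B ^ D \<le> C * Suc B ^ (D + D')" "C' * Suc B ^ D' \<le> C' * Suc B ^ (D + D')"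
      by (intro mult_le_mono2 power_increasing; simp)+
    with *(1)[of B] *(2)[of B] show ?thesis by (simp only: cost.simps distrib_right)
  qed
  then show ?case by blast
next
  case (Cond e p q)
  then obtain C D C' D' where *: "\<And>B. cost p B \<le> C * Suc B ^ D" "\<And>B. cost q B \<le> C' * Suc B ^ D'"
    by blast
  have "cost (Cond e p q) B \<le> (exp_time e + 1 + C + C') * Suc B ^ (D + D')" for B
  proof -
    have "C * Suc B ^ D \<le> C * Suc B ^ (D + D')" "C' * Suc B ^ D' \<le> C' * Suc B ^ (D + D')"
      by (intro mult_le_mono2 power_increasing; simp)+
    moreover have "(exp_time e + 1) * 1 \<le> (exp_time e + 1) * Suc B ^ (D + D')"
      by (intro mult_le_mono2) simp
    ultimately show ?thesis
      unfolding cost.simps distrib_right[of _ C'] distrib_right[of _ C]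
      by (intro add_mono order_trans[OF *(1)] order_trans[OF *(2)]) simp_all
  qed
  then show ?case by blast
next
  case (For i b p)
  then obtain C D where *: "\<And>B. cost p B \<le> C * Suc B ^ D" by blast
  \<comment> \<open>10 = 4 + 6 absorbs the setup and the overhead of the iterations.\<close>
  have "cost (For i b p) B \<le> (10 + C) * Suc B ^ Suc D" for B
  proof -
    have "B * cost p B \<le> Suc B * (C * Suc B ^ D)" using *[of B] by (intro mult_le_mono) auto
    moreover have "4 * 1 \<le> 4 * Suc B ^ Suc D" by (intro mult_le_mono2 one_le_power) simp
    moreover have "6 * B \<le> 6 * Suc B ^ Suc D"
      by (intro mult_le_mono2 le_trans[OF le_SucI[OF le_refl] self_le_power]) auto
    ultimately show ?thesis by (simp add: algebra_simps)
  qed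
  then show ?case by blast
qed

section \<open>Greedy extension of partial colourings\<close>

text \<open>As long as the iterates change, \<open>\<mu>\<close> drops, so at most
  \<open>\<mu> X\<close> applications change anything; after one idle application all later ones are
  idle too.\<close>

lemma funpow_decreasing_fixpoint:
  fixes \<mu> :: "'a \<Rightarrow> nat"
  assumes "\<And>X. P X \<Longrightarrow> P (f X)" "\<And>X. P X \<Longrightarrow> f X = X \<or> \<mu> (f X) < \<mu> X"
  shows "P X \<Longrightarrow> \<mu> X \<le> m \<Longrightarrow> f ((f ^^ m) X) = (f ^^ m) X"
proof (induction m arbitrary: X)
  case 0
  then show ?case using assms(2)[of X] by auto
next
  case (Suc m)
  show ?case
  proof (cases "f X = X")
    case True
    have "(f ^^ l) X = X" for l by (induction l) (simp_all add: True)
    then show ?thesis using True by simp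
  next
    case False
    then have "\<mu> (f X) \<le> m" using assms(2)[OF Suc.prems(1)] Suc.prems(2) by simp
    from Suc.IH[OF assms(1)[OF Suc.prems(1)] this] show ?thesis
      by (simp add: funpow_swap1)
  qed
qed

lemma fold_const_eq_funpow: "fold (\<lambda>_. f) xs = f ^^ length xs"
  by (induction xs) (auto simp: fun_eq_iff funpow_swap1)

text \<open>Programs use nested loops, whereas the inductions about the search run over one list of
  pairs.\<close>

lemma fold_product:
  "fold f (List.product xs ys) = fold (\<lambda>x. fold (\<lambda>y. f (x, y)) ys) xs"
proof (induction xs)
  case (Cons x xs)
  have "fold f (map (Pair x) ys) = fold (\<lambda>y. f (x, y)) ys"
    by (simp add: fold_map comp_def)
  with Cons show ?case by simp
qed simp

text \<open>
  Vertices of \<open>G\<close> are \<open>0, \<dots>, n - 1\<close>. Vertices of \<open>M\<close> are the colours \<open>1, \<dots>, k\<close>, and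
  the colour 0 marks a vertex of \<open>G\<close> without an image.
\<close>

locale matching_instance =
  fixes n k :: nat and adj :: "nat \<Rightarrow> nat \<Rightarrow> bool" and mate :: "nat \<Rightarrow> nat"
  assumes adj_sym: "\<lbrakk>x < n; y < n; adj x y\<rbrakk> \<Longrightarrow> adj y x"
    and mate_range: "c \<in> {1..k} \<Longrightarrow> mate c \<in> {1..k}"
    and mate_mate: "c \<in> {1..k} \<Longrightarrow> mate (mate c) = c"
begin

section \<open>Partial colourings and propagation\<close>

definition is_hom :: "(nat \<Rightarrow> nat) \<Rightarrow> bool" where
  "is_hom h \<longleftrightarrow>
     (\<forall>x < n. h x \<in> {1..k}) \<and> (\<forall>x y. x < y \<longrightarrow> y < n \<longrightarrow> h x \<le> h y) \<and>
     (\<forall>x < n. \<forall>y < n. adj x y \<longrightarrow> h y = mate (h x))"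

definition extends :: "(nat \<Rightarrow> nat) \<Rightarrow> (nat \<Rightarrow> nat) \<Rightarrow> bool" where
  "extends X Y \<longleftrightarrow> (\<forall>x < n. X x \<noteq> 0 \<longrightarrow> Y x = X x)"

definition palette :: "(nat \<Rightarrow> nat) \<Rightarrow> nat set" where
  "palette X = X ` {..<n} - {0}"

definition consistent :: "(nat \<Rightarrow> nat) \<Rightarrow> bool" where
  "consistent X \<longleftrightarrow>
     (\<forall>x < n. \<forall>y < n. X x \<noteq> 0 \<and> X y \<noteq> 0 \<longrightarrow>
        (adj x y \<longrightarrow> X y = mate (X x)) \<and> (x < y \<longrightarrow> X x \<le> X y))"

text \<open>Only the presence of a colour is required here; whether it is the right one is left to
  \<open>consistent\<close>.\<close>

definition closed :: "(nat \<Rightarrow> nat) \<Rightarrow> bool" where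
  "closed X \<longleftrightarrow>
     (\<forall>x < n. \<forall>y < n. adj x y \<and> X x \<noteq> 0 \<longrightarrow> X y \<noteq> 0) \<and>
     (\<forall>x y z. x < y \<and> y < z \<and> z < n \<and> X x \<noteq> 0 \<and> X z = X x \<longrightarrow> X y \<noteq> 0)"

text \<open>A blank is filled and nothing is ever overwritten, so propagation comes to rest even
  from a contradictory start; conflicts surface only in \<open>consistent\<close>.\<close>

definition edge_rule :: "nat \<Rightarrow> nat \<Rightarrow> (nat \<Rightarrow> nat) \<Rightarrow> nat \<Rightarrow> nat" where
  "edge_rule x y X = (if adj x y \<and> X x \<noteq> 0 \<and> X y = 0 then X(y := mate (X x)) else X)"

definition between_rule :: "nat \<Rightarrow> nat \<Rightarrow> nat \<Rightarrow> (nat \<Rightarrow> nat) \<Rightarrow> nat \<Rightarrow> nat" where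
  "between_rule x y z X =
     (if x < y \<and> y < z \<and> X x \<noteq> 0 \<and> X y = 0 \<and> X z = X x then X(y := X x) else X)"

definition round :: "(nat \<Rightarrow> nat) \<Rightarrow> nat \<Rightarrow> nat" where
  "round = fold (\<lambda>x. fold (\<lambda>y X. fold (between_rule x y) [0..<n] (edge_rule x y X)) [0..<n]) [0..<n]"

text \<open>Every round that changes something fills one of at most \<open>n\<close> blanks, hence
  \<open>n\<close> rounds reach a fixpoint.\<close>

definition closure :: "(nat \<Rightarrow> nat) \<Rightarrow> nat \<Rightarrow> nat" where
  "closure = fold (\<lambda>_. round) [0..<n]"

definition attempt :: "(nat \<Rightarrow> nat) \<Rightarrow> nat \<Rightarrow> nat \<Rightarrow> nat \<Rightarrow> nat" where
  "attempt X u c = closure (X(u := c))"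

definition colouring :: "(nat \<Rightarrow> nat) \<Rightarrow> bool" where
  "colouring X \<longleftrightarrow> (\<forall>x < n. X x \<le> k)"

text \<open>Closure of the palette under \<open>mate\<close> ensures that propagating a colour in
  use brings in no new colour, as \<open>exchange\<close> requires.\<close>

definition good :: "(nat \<Rightarrow> nat) \<Rightarrow> bool" where
  "good X \<longleftrightarrow> colouring X \<and> closed X \<and> consistent X \<and> mate ` palette X \<subseteq> palette X"

lemma round_invariant:
  assumes "P X"
    and "\<And>x y X. \<lbrakk>x < n; y < n; P X\<rbrakk> \<Longrightarrow> P (edge_rule x y X)"
    and "\<And>x y z X. \<lbrakk>x < n; y < n; z < n; P X\<rbrakk> \<Longrightarrow> P (between_rule x y z X)"
  shows "P (round X)"
  unfolding round_def
  by (intro fold_invariant[where Q = "\<lambda>x. x < n" and P = P] assms) auto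

lemma closure_invariant:
  assumes "P X"
    and "\<And>x y X. \<lbrakk>x < n; y < n; P X\<rbrakk> \<Longrightarrow> P (edge_rule x y X)"
    and "\<And>x y z X. \<lbrakk>x < n; y < n; z < n; P X\<rbrakk> \<Longrightarrow> P (between_rule x y z X)"
  shows "P (closure X)"
  unfolding closure_def
  by (rule fold_invariant[where Q = "\<lambda>_. True" and P = P])
    (auto intro: assms round_invariant[where P = P])

lemma mate_le: "colouring X \<Longrightarrow> x < n \<Longrightarrow> X x \<noteq> 0 \<Longrightarrow> mate (X x) \<le> k \<and> mate (X x) \<noteq> 0"
  using mate_range[of "X x"] by (auto simp: colouring_def)

lemma colouring_edge_rule: "x < n \<Longrightarrow> colouring X \<Longrightarrow> colouring (edge_rule x y X)"
  using mate_le[of X x] by (auto simp: edge_rule_def colouring_def)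

lemma colouring_between_rule: "x < n \<Longrightarrow> colouring X \<Longrightarrow> colouring (between_rule x y z X)"
  by (auto simp: between_rule_def colouring_def)

section \<open>Propagation reaches a closed colouring\<close>

definition blanks :: "(nat \<Rightarrow> nat) \<Rightarrow> nat" where
  "blanks X = card {x. x < n \<and> X x = 0}"

lemma blanks_update:
  assumes "y < n" "X y = 0" "c \<noteq> 0"
  shows "blanks (X(y := c)) < blanks X"
  unfolding blanks_def using assms by (intro psubset_card_mono) auto

definition progressive :: "((nat \<Rightarrow> nat) \<Rightarrow> nat \<Rightarrow> nat) \<Rightarrow> bool" where
  "progressive f \<longleftrightarrow>
     (\<forall>X. colouring X \<longrightarrow> colouring (f X) \<and> (f X = X \<or> blanks (f X) < blanks X))"

lemma progressive_edge_rule: "x < n \<Longrightarrow> y < n \<Longrightarrow> progressive (edge_rule x y)"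
  unfolding progressive_def
  by (auto simp: colouring_edge_rule) (auto simp: edge_rule_def blanks_update mate_le)

lemma progressive_between_rule: "x < n \<Longrightarrow> y < n \<Longrightarrow> progressive (between_rule x y z)"
  unfolding progressive_def
  by (auto simp: colouring_between_rule) (auto simp: between_rule_def blanks_update)

lemma progressive_comp:
  assumes "progressive f" "progressive g"
  shows "progressive (\<lambda>X. g (f X))"
  using assms unfolding progressive_def by (metis order_less_trans)

text \<open>\<open>blanks\<close> never rises and falls with every change, so a composition that
  returns to \<open>X\<close> cannot have left it in between.\<close>

lemma progressive_comp_fixpoint:
  assumes "progressive f" "progressive g" "colouring X" "g (f X) = X"
  shows "f X = X \<and> g X = X"
  using assms unfolding progressive_def by (metis order_less_asym)

lemma progressive_fold:
  assumes "\<And>x. x \<in> set xs \<Longrightarrow> progressive (f x)"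
  shows "progressive (fold f xs) \<and>
    (\<forall>X. colouring X \<and> fold f xs X = X \<longrightarrow> (\<forall>x \<in> set xs. f x X = X))"
  using assms
proof (induction xs)
  case Nil
  show ?case by (simp add: progressive_def)
next
  case (Cons x xs)
  then have *: "progressive (f x)" "progressive (fold f xs)"
    "\<And>X y. colouring X \<Longrightarrow> fold f xs X = X \<Longrightarrow> y \<in> set xs \<Longrightarrow> f y X = X"
    by auto
  show ?case
    using progressive_comp[OF *(1,2)] progressive_comp_fixpoint[OF *(1,2)] *(3)
    by (auto simp: comp_def)
qed

lemma progressive_row:
  assumes "x < n" "y < n"
  shows "progressive (\<lambda>X. fold (between_rule x y) [0..<n] (edge_rule x y X))"
proof (rule progressive_comp[OF progressive_edge_rule[OF assms], of "fold (between_rule x y) [0..<n]"])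
  show "progressive (fold (between_rule x y) [0..<n])"
    by (rule progressive_fold[THEN conjunct1]) (rule progressive_between_rule[OF assms])
qed

lemma progressive_rows:
  assumes "x < n"
  shows "progressive (fold (\<lambda>y X. fold (between_rule x y) [0..<n] (edge_rule x y X)) [0..<n])"
  by (rule progressive_fold[THEN conjunct1]) (simp add: progressive_row assms)

lemma progressive_round: "progressive round"
  unfolding round_def
  by (rule progressive_fold[THEN conjunct1]) (simp add: progressive_rows)

lemma fold_progressive_fixpoint:
  assumes "\<And>x. x < n \<Longrightarrow> progressive (f x)" "colouring X" "fold f [0..<n] X = X" "x < n"
  shows "f x X = X"
  using progressive_fold[of "[0..<n]" f] assms by auto

text \<open>A fixpoint of the round is split into fixpoints of all single rules. None of them can
  fire, for it would replace a blank by a nonzero colour.\<close>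

lemma closed_if_round_fixpoint:
  assumes "colouring X" "round X = X"
  shows "closed X"
proof -
  have rows: "fold (\<lambda>y X. fold (between_rule x y) [0..<n] (edge_rule x y X)) [0..<n] X = X"
    if "x < n" for x
    by (rule fold_progressive_fixpoint[OF progressive_rows assms(1) _ that])
      (use assms(2) in \<open>simp_all add: round_def\<close>)
  have row: "fold (between_rule x y) [0..<n] (edge_rule x y X) = X" if "x < n" "y < n" for x y
    by (rule fold_progressive_fixpoint[OF progressive_row[OF that(1)] assms(1) rows[OF that(1)] that(2)])
  have prog: "progressive (fold (between_rule x y) [0..<n])" if "x < n" "y < n" for x y
    by (rule progressive_fold[THEN conjunct1]) (rule progressive_between_rule[OF that])
  have *: "edge_rule x y X = X" "fold (between_rule x y) [0..<n] X = X" if "x < n" "y < n" for x y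
    using progressive_comp_fixpoint[where f = "edge_rule x y" and g = "fold (between_rule x y) [0..<n]"]
      progressive_edge_rule[OF that] prog[OF that] assms(1) row[OF that] by blast+
  have **: "between_rule x y z X = X" if "x < n" "y < n" "z < n" for x y z
    by (rule fold_progressive_fixpoint[OF progressive_between_rule[OF that(1,2)] assms(1)
        *(2)[OF that(1,2)] that(3)])
  show ?thesis unfolding closed_def
  proof (intro conjI allI impI)
    fix x y assume "x < n" "y < n" "adj x y \<and> X x \<noteq> 0"
    with *(1)[of x y] mate_le[OF assms(1), of x] show "X y \<noteq> 0"
      unfolding edge_rule_def by (metis fun_upd_same)
  next
    fix x y z assume "x < y \<and> y < z \<and> z < n \<and> X x \<noteq> 0 \<and> X z = X x"
    with **[of x y z] show "X y \<noteq> 0"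
      unfolding between_rule_def by (metis fun_upd_same order.strict_trans)
  qed
qed

lemma closure:
  assumes "colouring X"
  shows "colouring (closure X)" "closed (closure X)"
proof -
  show col: "colouring (closure X)"
    by (rule closure_invariant[where P = colouring])
      (auto intro: assms colouring_edge_rule colouring_between_rule)
  have "blanks X \<le> n"
    unfolding blanks_def using card_mono[of "{..<n}" "{x. x < n \<and> X x = 0}"] by auto
  with assms have "round (closure X) = closure X"
    unfolding closure_def fold_const_eq_funpow length_upt diff_zero
    using progressive_round unfolding progressive_def
    by (intro funpow_decreasing_fixpoint[where P = colouring and \<mu> = blanks]) auto
  with col show "closed (closure X)" by (rule closed_if_round_fixpoint)
qed

lemma extends_closure: "extends X (closure X)"
  by (rule closure_invariant[where P = "extends X"])
    (auto simp: extends_def edge_rule_def between_rule_def)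

section \<open>Colours in use, and propagation below a homomorphism\<close>

lemma palette_update: "palette (X(y := c)) \<subseteq> insert c (palette X)"
  by (auto simp: palette_def)

text \<open>The rules only copy a colour or pass to its mate.\<close>

lemma palette_closure:
  assumes "palette X \<subseteq> C" "mate ` C \<subseteq> C"
  shows "palette (closure X) \<subseteq> C"
proof (rule closure_invariant[where P = "\<lambda>Y. palette Y \<subseteq> C"])
  show "palette X \<subseteq> C" by (rule assms(1))
next
  fix x y X assume *: "x < n" "y < n" "palette X \<subseteq> C"
  have "X x \<in> C" if "X x \<noteq> 0" using that * by (auto simp: palette_def)
  then have "mate (X x) \<in> C" if "X x \<noteq> 0" using that assms(2) by blast
  then have "palette (X(y := mate (X x))) \<subseteq> C" if "X x \<noteq> 0"
    using that * palette_update[of X y "mate (X x)"] by blast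
  then show "palette (edge_rule x y X) \<subseteq> C"
    using * by (simp add: edge_rule_def)
next
  fix x y z X assume *: "x < n" "y < n" "palette X \<subseteq> C"
  have "X x \<in> C" if "X x \<noteq> 0" using that * by (auto simp: palette_def)
  then have "palette (X(y := X x)) \<subseteq> C" if "X x \<noteq> 0"
    using that * palette_update[of X y "X x"] by blast
  then show "palette (between_rule x y z X) \<subseteq> C"
    using * by (simp add: between_rule_def)
qed

lemma closure_extends_hom:
  assumes "is_hom h" "extends X h"
  shows "extends (closure X) h"
proof (rule closure_invariant[where P = "\<lambda>X. extends X h"])
  show "extends X h" by (rule assms(2))
next
  fix x y X assume "x < n" "y < n" "extends X h"
  then show "extends (edge_rule x y X) h"
    using assms(1) by (auto simp: extends_def edge_rule_def is_hom_def)
next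
  fix x y z X assume *: "x < n" "y < n" "z < n" "extends X h"
  have "h y = h x" if "x < y" "y < z" "h x = h z"
    using assms(1) that * unfolding is_hom_def by (metis order_antisym)
  with * show "extends (between_rule x y z X) h"
    by (auto simp: extends_def between_rule_def)
qed

text \<open>Together with \<open>closure_extends_hom\<close> this means that guessing
  \<open>h u\<close> for \<open>u\<close> never ends in a conflict.\<close>

lemma consistent_if_extends_hom:
  assumes "is_hom h" "extends X h"
  shows "consistent X"
proof -
  have "X x = h x" if "x < n" "X x \<noteq> 0" for x
    using assms(2) that by (simp add: extends_def)
  moreover have "h x \<le> h y" if "x < y" "y < n" for x y
    using assms(1) that by (simp add: is_hom_def)
  moreover have "h y = mate (h x)" if "x < n" "y < n" "adj x y" for x y
    using assms(1) that by (simp add: is_hom_def)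
  ultimately show ?thesis unfolding consistent_def by metis
qed

lemma palette_mono: "extends X Y \<Longrightarrow> palette X \<subseteq> palette Y"
  unfolding extends_def palette_def by force

lemma good_palette: "good X \<Longrightarrow> palette X \<subseteq> {1..k}"
  by (auto simp: good_def colouring_def palette_def)

lemma attempt:
  assumes "good X" "u < n" "X u = 0" "c \<in> {1..k}"
  shows "colouring (attempt X u c)" "closed (attempt X u c)" "extends X (attempt X u c)"
    "attempt X u c u = c" "palette (attempt X u c) \<subseteq> palette X \<union> {c, mate c}"
proof -
  have "colouring (X(u := c))" using assms by (auto simp: good_def colouring_def)
  from closure[OF this] show "colouring (attempt X u c)" "closed (attempt X u c)"
    by (simp_all add: attempt_def)
  show "extends X (attempt X u c)" "attempt X u c u = c"
    using extends_closure[of "X(u := c)"] assms by (auto simp: attempt_def extends_def)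
  show "palette (attempt X u c) \<subseteq> palette X \<union> {c, mate c}"
    unfolding attempt_def
  proof (rule palette_closure)
    show "palette (X(u := c)) \<subseteq> palette X \<union> {c, mate c}"
      using palette_update[of X u c] by blast
    show "mate ` (palette X \<union> {c, mate c}) \<subseteq> palette X \<union> {c, mate c}"
      using assms(1) mate_mate[OF assms(4)] by (auto simp: good_def)
  qed
qed

text \<open>The neighbour \<open>v\<close> supplies closure of the palette under
  \<open>mate\<close>: being closed, the attempt colours \<open>v\<close>, and being consistent, it
  gives \<open>v\<close> the colour \<open>mate c\<close>. So \<open>c\<close> and
  \<open>mate c\<close> enter the palette together.\<close>

lemma good_attempt:
  assumes "good X" "u < n" "X u = 0" "c \<in> {1..k}" "v < n" "adj u v"
    and cons: "consistent (attempt X u c)"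
  shows "good (attempt X u c)"
proof -
  let ?Y = "attempt X u c"
  note att = attempt[OF assms(1-4)]
  have c0: "c \<noteq> 0" using assms(4) by simp
  have "?Y v \<noteq> 0" using att(2,4) assms(2,5,6) c0 unfolding closed_def by metis
  with cons have "?Y v = mate c" using att(4) assms(2,5,6) c0 unfolding consistent_def by metis
  with \<open>?Y v \<noteq> 0\<close> have "mate c \<in> palette ?Y" using assms(5) by (force simp: palette_def)
  moreover have "c \<in> palette ?Y" using att(4) assms(2) c0 by (force simp: palette_def)
  moreover have "mate ` palette X \<subseteq> palette ?Y"
    using assms(1) palette_mono[OF att(3)] by (auto simp: good_def)
  ultimately have "mate x \<in> palette ?Y" if "x \<in> palette ?Y" for x
    using subsetD[OF att(5) that] mate_mate[OF assms(4)] by auto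
  then have "mate ` palette ?Y \<subseteq> palette ?Y" by blast
  with att cons show ?thesis by (simp add: good_def)
qed

text \<open>
  Overwriting a homomorphism by a larger partial solution is harmless as long as no new
  colour appears: every recoloured vertex is separated from its uncoloured neighbours in
  the order by a vertex whose colour was already fixed.
\<close>

lemma exchange:
  assumes h: "is_hom h" "extends X h" and Y: "good Y" "extends X Y" "palette Y \<subseteq> palette X"
  shows "\<exists>h'. is_hom h' \<and> extends Y h'"
proof -
  define h' where "h' x = (if Y x \<noteq> 0 then Y x else h x)" for x
  \<comment> \<open>A colour of \<open>Y\<close> already occurs in \<open>X\<close>; at a vertex
    \<open>w\<close> where it does, \<open>h\<close> and \<open>Y\<close> agree because both extend
    \<open>X\<close>.\<close>
  have witness: "\<exists>w < n. h w = Y x \<and> Y w = Y x" if "x < n" "Y x \<noteq> 0" for x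
  proof -
    from that have "Y x \<in> palette X" using Y(3) by (auto simp: palette_def)
    then obtain w where "w < n" "X w = Y x" "X w \<noteq> 0" by (auto simp: palette_def)
    with h(2) Y(2) show ?thesis unfolding extends_def by metis
  qed
  have closed: "closed Y" and cons: "consistent Y" and col: "colouring Y"
    using Y(1) by (auto simp: good_def)
  have "h' x \<le> h' y" if xy: "x < y" "y < n" for x y
  proof -
    have x: "x < n" using xy by simp
    consider "Y x \<noteq> 0" "Y y \<noteq> 0" | "Y x = 0" "Y y = 0" | "Y x \<noteq> 0" "Y y = 0" | "Y x = 0" "Y y \<noteq> 0"
      by blast
    then show ?thesis
    proof cases
      case 1
      then show ?thesis using cons xy x by (auto simp: h'_def consistent_def)
    next
      case 2
      then show ?thesis using h(1) xy by (auto simp: h'_def is_hom_def)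
    next
      case 3
      from witness[OF x 3(1)] obtain w where w: "w < n" "h w = Y x" "Y w = Y x" by blast
      \<comment> \<open>A blank \<open>y\<close> between \<open>x\<close> and \<open>w\<close>,
        which share a colour, would contradict closedness. So \<open>w\<close> lies before
        \<open>y\<close>, and \<open>Y x = h w \<le> h y\<close>. The last case is the mirror
        image.\<close>
      have "\<not> y < w" using closed xy w 3 unfolding closed_def by metis
      moreover have "w \<noteq> y" using w 3 by metis
      ultimately have "w < y" by simp
      then have "h w \<le> h y" using h(1) xy unfolding is_hom_def by blast
      then show ?thesis using 3 w by (simp add: h'_def)
    next
      case 4
      from witness[OF xy(2) 4(2)] obtain w where w: "w < n" "h w = Y y" "Y w = Y y" by blast
      have "\<not> w < x" using closed xy w 4 unfolding closed_def by metis
      moreover have "w \<noteq> x" using w 4 by metis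
      ultimately have "x < w" by simp
      then have "h x \<le> h w" using h(1) w unfolding is_hom_def by blast
      then show ?thesis using 4 w by (simp add: h'_def)
    qed
  qed
  moreover have "h' y = mate (h' x)" if "x < n" "y < n" "adj x y" for x y
  proof (cases "Y x = 0")
    case True
    \<comment> \<open>Closedness is applied from \<open>y\<close> to \<open>x\<close>: an edge never
      joins a coloured and a blank vertex.\<close>
    then have "Y y = 0" using closed that adj_sym unfolding closed_def by metis
    with True show ?thesis using h(1) that by (simp add: h'_def is_hom_def)
  next
    case False
    then have "Y y \<noteq> 0" using closed that unfolding closed_def by metis
    with False show ?thesis using cons that by (simp add: h'_def consistent_def)
  qed
  moreover have "h' x \<in> {1..k}" if "x < n" for x
    using that h(1) col by (auto simp: h'_def is_hom_def colouring_def)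
  ultimately have "is_hom h'" by (simp add: is_hom_def)
  moreover have "extends Y h'" by (simp add: extends_def h'_def)
  ultimately show ?thesis by blast
qed

text \<open>
  A search state consists of a partial colouring, of the code that is still to be read as a
  sequence of base \<open>k\<close> digits, and of a flag that is 0 once the code has been rejected. A
  digit is consumed only when no colour in use fits.
\<close>

definition join_step :: "nat \<Rightarrow> nat \<Rightarrow> (nat \<Rightarrow> nat) \<times> nat \<Rightarrow> (nat \<Rightarrow> nat) \<times> nat" where
  "join_step u a = (\<lambda>(X, d).
     if d = 0 \<and> Suc a \<in> palette X \<and> consistent (attempt X u (Suc a))
     then (attempt X u (Suc a), 1) else (X, d))"

definition join :: "nat \<Rightarrow> (nat \<Rightarrow> nat) \<Rightarrow> (nat \<Rightarrow> nat) \<times> nat" where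
  "join u X = fold (join_step u) [0..<k] (X, 0)"

text \<open>Digits range over \<open>0..k-1\<close> and colours over \<open>1..k\<close>, hence
  \<open>Suc\<close>. The next digit is the lowest one, taken by \<open>mod\<close> and dropped by
  \<open>div\<close>. After a failure the flag 0 turns all later visits into no-ops. A single sweep
  over the pairs is enough, since colours are never erased.\<close>

definition visit :: "nat \<times> nat \<Rightarrow> (nat \<Rightarrow> nat) \<times> nat \<times> nat \<Rightarrow> (nat \<Rightarrow> nat) \<times> nat \<times> nat" where
  "visit = (\<lambda>(u, v) (X, c, ok).
     if adj u v \<and> X u = 0 \<and> ok \<noteq> 0 then
       (let (Y, d) = join u X in
        if d \<noteq> 0 then (Y, c, 1)
        else if consistent (attempt Y u (Suc (c mod k))) then (attempt Y u (Suc (c mod k)), c div k, 1)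
        else (Y, c div k, 0))
     else (X, c, ok))"

section \<open>Soundness and completeness of the greedy search\<close>

lemma join_result:
  assumes "good X" "join u X = (Y, d)"
  shows "d = 0 \<and> Y = X \<and> (\<forall>c \<in> palette X. \<not> consistent (attempt X u c)) \<or>
    d \<noteq> 0 \<and> (\<exists>c \<in> palette X. Y = attempt X u c \<and> consistent Y)"
proof -
  have "(case fold (join_step u) as (X, 0) of (Y, d) \<Rightarrow>
      d = 0 \<and> Y = X \<and> (\<forall>a \<in> set as. Suc a \<in> palette X \<longrightarrow> \<not> consistent (attempt X u (Suc a))) \<or>
      d \<noteq> 0 \<and> (\<exists>c \<in> palette X. Y = attempt X u c \<and> consistent Y))" for as
    \<comment> \<open>Reverse induction follows the order in which \<open>fold\<close> meets the
      candidates; once the flag is set, \<open>join_step\<close> is idle and the first fitting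
      colour stays.\<close>
    by (induction as rule: rev_induct) (auto simp: join_step_def split: prod.splits if_splits)
  from this[of "[0..<k]"] have *: "d = 0 \<and> Y = X \<and>
      (\<forall>a < k. Suc a \<in> palette X \<longrightarrow> \<not> consistent (attempt X u (Suc a))) \<or>
      d \<noteq> 0 \<and> (\<exists>c \<in> palette X. Y = attempt X u c \<and> consistent Y)"
    using assms(2) by (auto simp: join_def)
  have "\<exists>a < k. c = Suc a" if "c \<in> palette X" for c
    using subsetD[OF good_palette[OF assms(1)] that] by (cases c) auto
  with * show ?thesis by metis
qed

text \<open>\<open>visit\<close> sets its flag to 1, whereas the program copies the flag of
  \<open>join\<close>; this bound identifies the two.\<close>

lemma join_flag: "snd (join u X) \<le> 1"
  unfolding join_def
  by (rule fold_invariant[where Q = "\<lambda>_. True" and P = "\<lambda>s. snd s \<le> 1"])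
    (auto simp: join_step_def split: if_splits)

lemma card_palette: "good X \<Longrightarrow> card (palette X) \<le> k"
  using card_mono[OF _ good_palette, of X] by simp

lemma visit_cases:
  assumes "good X" "u < n" "v < n" "k > 0" "visit (u, v) (X, c, 1) = (Y, c', ok)"
  obtains
    (skip) "\<not> adj u v \<or> X u \<noteq> 0" "Y = X" "c' = c" "ok = 1"
  | (join) a where "adj u v" "X u = 0" "a \<in> palette X" "Y = attempt X u a" "good Y" "c' = c" "ok = 1"
  | (fresh) "adj u v" "X u = 0" "\<And>a. a \<in> palette X \<Longrightarrow> \<not> consistent (attempt X u a)"
      "Y = attempt X u (Suc (c mod k))" "good Y" "c' = c div k" "ok = 1"
  | (fail) "adj u v" "X u = 0" "\<And>a. a \<in> palette X \<Longrightarrow> \<not> consistent (attempt X u a)"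
      "\<not> consistent (attempt X u (Suc (c mod k)))" "ok = 0"
proof (cases "adj u v \<and> X u = 0")
  case False
  then show ?thesis using assms(5) by (intro skip) (auto simp: visit_def)
next
  case True
  obtain Z d where j: "join u X = (Z, d)" by fastforce
  have colour: "Suc (c mod k) \<in> {1..k}" using assms(4) by (simp add: Suc_le_eq)
  from join_result[OF assms(1) j] show ?thesis
  proof (elim disjE conjE bexE)
    assume d: "d = 0" "Z = X" "\<forall>c \<in> palette X. \<not> consistent (attempt X u c)"
    show ?thesis
    proof (cases "consistent (attempt X u (Suc (c mod k)))")
      case T: True
      with True d j assms(5) have "Y = attempt X u (Suc (c mod k))" "c' = c div k" "ok = 1"
        by (auto simp: visit_def)
      with d T True show ?thesis
        using good_attempt[OF assms(1,2) _ colour assms(3)] by (intro fresh) auto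
    next
      case F: False
      with True d j assms(5) show ?thesis by (intro fail) (auto simp: visit_def)
    qed
  next
    fix a assume d: "d \<noteq> 0" "a \<in> palette X" "Z = attempt X u a" "consistent Z"
    with True j assms(5) have "Y = Z" "c' = c" "ok = 1" by (auto simp: visit_def)
    moreover have "a \<in> {1..k}" using good_palette[OF assms(1)] d(2) by blast
    then have "good Z"
      unfolding d(3) using True d by (intro good_attempt[OF assms(1,2) _ _ assms(3)]) auto
    ultimately show ?thesis using True d by (intro join[of a]) auto
  qed
qed

text \<open>The palette of a good colouring contains \<open>mate a\<close> along with
  \<open>a\<close>. This provides the palette hypothesis of \<open>exchange\<close>.\<close>

lemma palette_attempt_used:
  assumes "good X" "u < n" "X u = 0" "a \<in> palette X"
  shows "palette (attempt X u a) \<subseteq> palette X"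
proof -
  have "a \<in> {1..k}" using good_palette[OF assms(1)] assms(4) by blast
  from attempt(5)[OF assms(1-3) this] show ?thesis
    using assms(1,4) by (auto simp: good_def)
qed

lemma fold_visit_failed: "fold visit us (X, c, 0) = (X, c, 0)"
proof (induction us)
  case (Cons uv us)
  then show ?case by (cases uv) (simp add: visit_def)
qed simp

text \<open>A nonzero final flag excludes failure at every visit, each successful visit leaves the
  first end of its edge coloured, and later visits only extend the colouring.\<close>

lemma fold_visit_sound:
  assumes "good X" "k > 0" "set us \<subseteq> {..<n} \<times> {..<n}" "fold visit us (X, c, 1) = (Y, c', ok)" "ok \<noteq> 0"
  shows "good Y \<and> extends X Y \<and> (\<forall>(u, v) \<in> set us. adj u v \<longrightarrow> Y u \<noteq> 0)"
  using assms
proof (induction us arbitrary: X c)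
  case Nil
  then show ?case by (auto simp: extends_def)
next
  case (Cons uv us)
  obtain u v where uv: "uv = (u, v)" by fastforce
  have un: "u < n" and vn: "v < n" using Cons.prems(3) uv by auto
  obtain Z c1 ok1 where vis: "visit (u, v) (X, c, 1) = (Z, c1, ok1)" by (metis prod_cases3)
  with Cons.prems(4) uv have rest: "fold visit us (Z, c1, ok1) = (Y, c', ok)" by simp
  from Cons.prems(1) un vn Cons.prems(2) vis
  have "ok1 = 1 \<and> good Z \<and> extends X Z \<and> (adj u v \<longrightarrow> Z u \<noteq> 0)"
  proof (cases rule: visit_cases)
    case skip
    then show ?thesis using Cons.prems(1) by (auto simp: extends_def)
  next
    case (join a)
    have "a \<in> {1..k}" using good_palette[OF Cons.prems(1)] join by blast
    then show ?thesis
      using join attempt(3,4)[OF Cons.prems(1) un join(2), of a] by auto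
  next
    case fresh
    have "Suc (c mod k) \<in> {1..k}" using Cons.prems(2) by (simp add: Suc_le_eq)
    then show ?thesis
      using fresh attempt(3,4)[OF Cons.prems(1) un fresh(2), of "Suc (c mod k)"] by auto
  next
    case fail
    then show ?thesis using rest fold_visit_failed[of us Z c1] Cons.prems(5) by simp
  qed
  then have Z: "ok1 = 1" "good Z" "extends X Z" "adj u v \<longrightarrow> Z u \<noteq> 0" by auto
  have "good Y \<and> extends Z Y \<and> (\<forall>(u, v) \<in> set us. adj u v \<longrightarrow> Y u \<noteq> 0)"
    using Cons.IH[OF Z(2) Cons.prems(2) _ _ Cons.prems(5)] Cons.prems(3) rest Z(1) by simp
  with Z un uv show ?case unfolding extends_def by auto
qed

text \<open>The homomorphism dictates the code. Reusing a colour consumes no digit and does not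
  enlarge the palette, but may spoil \<open>h\<close>; \<open>exchange\<close> then provides another
  homomorphism, which is why \<open>h\<close> varies in the induction. A fresh colour consumes the
  digit \<open>h u - 1\<close> and enlarges the palette, so at most
  \<open>k - card (palette X)\<close> digits are ever read.\<close>

lemma fold_visit_complete:
  assumes "good X" "k > 0" "set us \<subseteq> {..<n} \<times> {..<n}" "is_hom h" "extends X h"
  shows "\<exists>c < k ^ (k - card (palette X)). snd (snd (fold visit us (X, c, 1))) \<noteq> 0"
  using assms
proof (induction us arbitrary: X h)
  case Nil
  then show ?case by (intro exI[of _ 0]) simp
next
  case (Cons uv us)
  obtain u v where uv: "uv = (u, v)" by fastforce
  have un: "u < n" and vn: "v < n" and us: "set us \<subseteq> {..<n} \<times> {..<n}" using Cons.prems(3) uv by auto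
  note cases = visit_cases[OF Cons.prems(1) un vn Cons.prems(2)]
  consider (skip) "\<not> adj u v \<or> X u \<noteq> 0"
    | (join) a where "adj u v" "X u = 0" "a \<in> palette X" "consistent (attempt X u a)"
    | (fresh) "adj u v" "X u = 0" "\<And>a. a \<in> palette X \<Longrightarrow> \<not> consistent (attempt X u a)"
    by blast
  then show ?case
  proof cases
    case skip
    then have "visit uv (X, c, 1) = (X, c, 1)" for c by (auto simp: visit_def uv)
    then show ?thesis using Cons.IH[OF Cons.prems(1,2) us Cons.prems(4,5)] by simp
  next
    case (join a)
    obtain Y d where j: "join u X = (Y, d)" by fastforce
    from join_result[OF Cons.prems(1) j] join
    obtain b where b: "d \<noteq> 0" "b \<in> palette X" "Y = attempt X u b" "consistent Y"
      by blast
    have step: "visit uv (X, c, 1) = (Y, c, 1)" for c using b(1) j join by (simp add: visit_def uv)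
    have brange: "b \<in> {1..k}" using good_palette[OF Cons.prems(1)] b(2) by blast
    have Y: "good Y"
      using good_attempt[OF Cons.prems(1) un join(2) brange vn join(1)] b by simp
    have ext: "extends X Y" using attempt(3)[OF Cons.prems(1) un join(2) brange] b(3) by simp
    have pal: "palette Y \<subseteq> palette X"
      using palette_attempt_used[OF Cons.prems(1) un join(2) b(2)] b(3) by simp
    from exchange[OF Cons.prems(4,5) Y ext pal] obtain h' where "is_hom h'" "extends Y h'" by blast
    moreover have "palette Y = palette X" using pal palette_mono[OF ext] by blast
    ultimately show ?thesis using Cons.IH[OF Y Cons.prems(2) us, of h'] step by simp
  next
    case fresh
    let ?a = "h u"
    let ?Y = "attempt X u ?a"
    have a: "?a \<in> {1..k}" using Cons.prems(4) un by (simp add: is_hom_def)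
    have "extends (X(u := ?a)) h" using Cons.prems(5) by (simp add: extends_def)
    then have ext: "extends ?Y h"
      unfolding attempt_def by (rule closure_extends_hom[OF Cons.prems(4)])
    then have cons: "consistent ?Y" by (rule consistent_if_extends_hom[OF Cons.prems(4)])
    then have new: "?a \<notin> palette X" using fresh(3) by blast
    have Y: "good ?Y" using good_attempt[OF Cons.prems(1) un fresh(2) a vn fresh(1) cons] .
    have "?a \<in> palette ?Y"
      using attempt(4)[OF Cons.prems(1) un fresh(2) a] un a by (force simp: palette_def)
    then have "palette X \<subset> palette ?Y"
      using new palette_mono[OF attempt(3)[OF Cons.prems(1) un fresh(2) a]] by blast
    then have "card (palette X) < card (palette ?Y)"
      by (intro psubset_card_mono) (simp_all add: palette_def)
    \<comment> \<open>The subtraction is truncated; the bound \<open>k\<close> on the larger palette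
      guarantees that the exponent really drops.\<close>
    with card_palette[OF Y] have le: "Suc (k - card (palette ?Y)) \<le> k - card (palette X)" by simp
    from Cons.IH[OF Y Cons.prems(2) us Cons.prems(4) ext] obtain c where
      c: "c < k ^ (k - card (palette ?Y))" "snd (snd (fold visit us (?Y, c, 1))) \<noteq> 0" by blast
    \<comment> \<open>The digit for \<open>u\<close> is read first, so it is put below the code
      \<open>c\<close> for the remaining visits.\<close>
    let ?c = "c * k + (?a - 1)"
    obtain b where b: "?a = Suc b" "b < k" using a by (cases ?a) auto
    then have digits: "?c mod k = ?a - 1" "?c div k = c" by simp_all
    have "?c < Suc c * k" using a by auto
    also have "Suc c * k \<le> k ^ (k - card (palette ?Y)) * k" using c(1) by (intro mult_le_mono1) simp
    also have "\<dots> = k ^ Suc (k - card (palette ?Y))" by simp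
    also have "\<dots> \<le> k ^ (k - card (palette X))" using le Cons.prems(2) by (intro power_increasing) simp_all
    finally have bound: "?c < k ^ (k - card (palette X))" .
    obtain Z c' ok where vis: "visit (u, v) (X, ?c, 1) = (Z, c', ok)" by (metis prod_cases3)
    have dig: "Suc (?c mod k) = ?a" using digits(1) b(1) by simp
    from vis have "(Z, c', ok) = (?Y, c, 1)"
    proof (rule cases)
      fix d assume "d \<in> palette X" "Z = attempt X u d" "good Z"
      with fresh(3)[of d] show ?thesis by (simp add: good_def)
    qed (use fresh(1,2) cons in \<open>simp_all only: dig digits(2), simp_all\<close>)
    then have "snd (snd (fold visit (uv # us) (X, ?c, 1))) \<noteq> 0"
      using vis c(2) uv by simp
    with bound show ?thesis by blast
  qed
qed

text \<open>Blank vertices have no neighbours, so only monotonicity matters for them: each takes the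
  largest colour seen up to it, or 1 if there is none. Coloured vertices keep their colour, because
  consistency makes \<open>X\<close> monotone on them and the zeros of blanks do not affect a
  maximum.\<close>

lemma hom_of_good:
  assumes "good X" "k > 0" "\<And>x y. x < n \<Longrightarrow> y < n \<Longrightarrow> adj x y \<Longrightarrow> X x \<noteq> 0"
  shows "\<exists>h. is_hom h"
proof -
  define h where "h x = Max (insert 1 (X ` {..x}))" for x
  have col: "colouring X" and cons: "consistent X" using assms(1) by (auto simp: good_def)
  have coloured: "h x = X x" if "x < n" "X x \<noteq> 0" for x
    unfolding h_def
  proof (rule Max_eqI)
    fix c assume "c \<in> insert 1 (X ` {..x})"
    moreover have "X w \<le> X x" if "w \<le> x" for w
    proof (cases "w = x \<or> X w = 0")
      case False
      then show ?thesis using cons that \<open>x < n\<close> \<open>X x \<noteq> 0\<close> unfolding consistent_def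
        by (metis le_neq_implies_less order.strict_trans)
    qed auto
    ultimately show "c \<le> X x" using that by auto
  qed auto
  have "h x \<in> {1..k}" if "x < n" for x
  proof -
    have "h x \<in> insert 1 (X ` {..x})" unfolding h_def by (rule Max_in) auto
    moreover have "1 \<le> h x" unfolding h_def by (rule Max_ge) auto
    ultimately show ?thesis using col that assms(2) by (auto simp: colouring_def)
  qed
  moreover have "h x \<le> h y" if "x < y" for x y
    unfolding h_def using that by (intro Max_mono) auto
  moreover have "h y = mate (h x)" if "x < n" "y < n" "adj x y" for x y
    using coloured assms(3) adj_sym that cons unfolding consistent_def by metis
  ultimately show ?thesis unfolding is_hom_def by blast
qed

definition accepts :: "nat \<Rightarrow> bool" where
  "accepts c \<longleftrightarrow> snd (snd (fold (\<lambda>u. fold (\<lambda>v. visit (u, v)) [0..<n]) [0..<n] (\<lambda>_. 0, c, 1))) \<noteq> 0"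

text \<open>The blank colouring is good and has an empty palette, so \<open>k\<close> digits
  suffice; \<open>k < 2 ^ k\<close> trades \<open>k ^ k\<close> for
  \<open>2 ^ (k * k)\<close>.\<close>

theorem hom_iff_accepts:
  assumes "k > 0"
  shows "(\<exists>h. is_hom h) \<longleftrightarrow> (\<exists>c < 2 ^ (k * k). accepts c)"
proof -
  let ?us = "List.product [0..<n] [0..<n]"
  have accepts: "accepts c \<longleftrightarrow> snd (snd (fold visit ?us (\<lambda>_. 0, c, 1))) \<noteq> 0" for c
    unfolding accepts_def fold_product ..
  have "palette (\<lambda>_. 0) = {}" by (auto simp: palette_def)
  then have good: "good (\<lambda>_. 0)"
    by (simp add: good_def colouring_def closed_def consistent_def)
  have us: "set ?us \<subseteq> {..<n} \<times> {..<n}" by auto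
  show ?thesis
  proof
    assume "\<exists>h. is_hom h"
    then obtain h where "is_hom h" by blast
    moreover have "extends (\<lambda>_. 0) h" by (simp add: extends_def)
    ultimately obtain c where "c < k ^ (k - card (palette (\<lambda>_. 0)))" "accepts c"
      using fold_visit_complete[OF good assms us] accepts by blast
    moreover have "k ^ (k - card (palette (\<lambda>_. 0))) \<le> k ^ k"
      using assms by (intro power_increasing) simp_all
    moreover have "k ^ k \<le> (2 ^ k) ^ k" by (intro power_mono) (simp_all add: less_imp_le)
    moreover have "(2 ^ k) ^ k = (2 ^ (k * k) :: nat)" by (simp add: power_mult)
    ultimately show "\<exists>c < 2 ^ (k * k). accepts c"
      by (metis order_less_le_trans)
  next
    assume "\<exists>c < 2 ^ (k * k). accepts c"
    then obtain c X c' ok where "fold visit ?us (\<lambda>_. 0, c, 1) = (X, c', ok)" "ok \<noteq> 0"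
      unfolding accepts by (metis prod.collapse)
    from fold_visit_sound[OF good assms us this]
    have "good X" and "\<forall>(x, y) \<in> set ?us. adj x y \<longrightarrow> X x \<noteq> 0" by blast+
    then have "good X" "\<And>x y. x < n \<Longrightarrow> y < n \<Longrightarrow> adj x y \<Longrightarrow> X x \<noteq> 0" by force+
    with assms show "\<exists>h. is_hom h" by (intro hom_of_good[of X]) auto
  qed
qed

end

section \<open>The search as a loop program\<close>

abbreviation (input) "r_len \<equiv> 2 :: nat"
abbreviation (input) "r_n \<equiv> 3 :: nat"
abbreviation (input) "r_k \<equiv> 4 :: nat"
abbreviation (input) "r_codes \<equiv> 5 :: nat"
abbreviation (input) "r_stop \<equiv> 6 :: nat"
abbreviation (input) "r_i \<equiv> 7 :: nat"
abbreviation (input) "r_j \<equiv> 8 :: nat"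
abbreviation (input) "r_base \<equiv> 9 :: nat"
abbreviation (input) "r_p \<equiv> 10 :: nat"
abbreviation (input) "r_q \<equiv> 11 :: nat"
abbreviation (input) "r_a \<equiv> 12 :: nat"
abbreviation (input) "r_u \<equiv> 13 :: nat"
abbreviation (input) "r_v \<equiv> 14 :: nat"
abbreviation (input) "r_x \<equiv> 15 :: nat"
abbreviation (input) "r_y \<equiv> 16 :: nat"
abbreviation (input) "r_z \<equiv> 17 :: nat"
abbreviation (input) "r_code \<equiv> 18 :: nat"
abbreviation (input) "r_ok \<equiv> 19 :: nat"
abbreviation (input) "r_done \<equiv> 20 :: nat"
abbreviation (input) "r_used \<equiv> 21 :: nat"
abbreviation (input) "r_round \<equiv> 22 :: nat"
abbreviation (input) "r_good \<equiv> 23 :: nat"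
abbreviation (input) "r_t \<equiv> 24 :: nat"
abbreviation (input) "r_ans \<equiv> 25 :: nat"
abbreviation (input) "r_quot \<equiv> 26 :: nat"
abbreviation (input) "r_rem \<equiv> 27 :: nat"

text \<open>Nonzero values count as true. Truncated subtraction expresses the connectives, and
  \<open>Less\<close> is a bare difference, of which only being zero is meaningful.\<close>

definition Neg :: "exp \<Rightarrow> exp" where
  "Neg e = Minus (Num 1) e"

definition And :: "exp \<Rightarrow> exp \<Rightarrow> exp" where
  "And a b = Minus (Num 1) (Plus (Minus (Num 1) a) (Minus (Num 1) b))"

definition Eq :: "exp \<Rightarrow> exp \<Rightarrow> exp" where
  "Eq a b = Minus (Num 1) (Plus (Minus a b) (Minus b a))"

definition Less :: "exp \<Rightarrow> exp \<Rightarrow> exp" where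
  "Less a b = Minus b a"

definition When :: "exp \<Rightarrow> prog \<Rightarrow> prog" where
  "When e p = Cond e p Skip"

lemma eval_Neg [simp]: "eval w (Neg a) s = (if eval w a s = 0 then 1 else 0)"
  by (simp add: Neg_def)

lemma eval_And [simp]: "eval w (And a b) s = (if eval w a s = 0 \<or> eval w b s = 0 then 0 else 1)"
  by (simp add: And_def)

lemma eval_Eq [simp]: "eval w (Eq a b) s = (if eval w a s = eval w b s then 1 else 0)"
  by (auto simp: Eq_def)

lemma eval_Less [simp]: "eval w (Less a b) s = 0 \<longleftrightarrow> eval w b s \<le> eval w a s"
  by (simp add: Less_def)

lemma run_When [simp]: "run w (When e p) s = (if eval w e s = 0 then s else run w p s)"
  by (simp add: When_def)

lemma When_frame [simp]: "mods (When e p) = mods p" "writes (When e p) = writes p"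
    "bounds (When e p) = bounds p"
  by (simp_all add: When_def)

lemma fst_set_reg [simp]: "fst (set_reg r c s) r' = (if r' = r then c else fst s r')"
  by (simp add: set_reg_def)

lemma snd_set_reg [simp]: "snd (set_reg r c s) = snd s"
  by (simp add: set_reg_def)

lemma fst_set_cell [simp]: "fst (set_cell a i c s) = fst s"
  by (simp add: set_cell_def)

lemma snd_set_cell [simp]:
  "snd (set_cell a i c s) a' = (if a' = a then (snd s a)(i := c) else snd s a')"
  by (simp add: set_cell_def)

declare run.simps(6) [simp del]

section \<open>Invariant and simulation rules for loops\<close>

lemma fold_indexed_invariant:
  assumes "I 0 s" "\<And>j s. j < N \<Longrightarrow> I j s \<Longrightarrow> I (Suc j) (f j s)"
  shows "I N (fold f [0..<N] s)"
proof -
  have "m \<le> N \<Longrightarrow> I m (fold f [0..<m] s)" for m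
    by (induction m) (use assms in auto)
  then show ?thesis by simp
qed

lemma run_For:
  assumes "I 0 s" "fst s b = N"
    "\<And>j s. j < N \<Longrightarrow> I j s \<Longrightarrow> I (Suc j) (run w p (set_reg i j s))"
  shows "I N (run w (For i b p) s)"
  using fold_indexed_invariant[where I = I, OF assms(1,3)] assms(2) by (simp add: run.simps)

text \<open>A simulation rule: \<open>\<alpha>\<close> reads an abstract state off the environment,
  \<open>g\<close> is the abstract step, and \<open>J\<close> collects what the body needs
  besides.\<close>

lemma run_For_fold:
  assumes "J s" "fst s b = N"
    and step: "\<And>j s. j < N \<Longrightarrow> J s \<Longrightarrow>
      J (run w p (set_reg i j s)) \<and> \<alpha> (run w p (set_reg i j s)) = g j (\<alpha> s)"
  shows "J (run w (For i b p) s) \<and> \<alpha> (run w (For i b p) s) = fold g [0..<N] (\<alpha> s)"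
  by (rule run_For[where I = "\<lambda>j s'. J s' \<and> \<alpha> s' = fold g [0..<j] (\<alpha> s)"])
    (use assms in auto)

text \<open>
  Since the machine cannot multiply, a pointer moves along a square matrix stored row by row.
\<close>

definition scan :: "nat \<Rightarrow> exp \<Rightarrow> nat \<Rightarrow> nat \<Rightarrow> nat \<Rightarrow> prog \<Rightarrow> prog" where
  "scan q e x y b p =
     Assign q e ;; For x b (For y b (p ;; Assign q (Plus (Reg q) (Num 1))))"

lemma scan_frame [simp]: "mods (scan q e x y b p) = mods p \<union> {q, x, y}"
    "writes (scan q e x y b p) = writes p" "bounds (scan q e x y b p) = insert b (bounds p)"
  by (auto simp: scan_def)

text \<open>\<open>J u v\<close> describes the moment after \<open>u\<close> complete rows and
  \<open>v\<close> entries of the next one; \<open>row\<close> moves from the end of a row to the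
  start of the following one.\<close>

lemma run_scan:
  assumes "J 0 0 s" "fst s b = N" "distinct [q, x, y, b]" "q \<notin> mods p" "x \<notin> mods p" "b \<notin> mods p"
    and stable: "\<And>u v r c s. r \<in> {q, x, y} \<Longrightarrow> J u v s \<Longrightarrow> J u v (set_reg r c s)"
    and row: "\<And>u s. J u N s \<Longrightarrow> J (Suc u) 0 s"
    and step: "\<And>u v s. \<lbrakk>u < N; v < N; J u v s; fst s x = u; fst s y = v;
      fst s q = eval w e s0 + u * N + v\<rbrakk> \<Longrightarrow> J u (Suc v) (run w p s)"
    and s0: "eval w e s = eval w e s0"
  shows "J N 0 (run w (scan q e x y b p) s)"
proof -
  let ?p = "p ;; Assign q (Plus (Reg q) (Num 1))"
  let ?B = "eval w e s0"
  define I where "I u v s \<longleftrightarrow> J u v s \<and> fst s b = N \<and> fst s q = ?B + u * N + v" for u v s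
  have inner: "I u N (run w (For y b ?p) s)" if "u < N" "I u 0 s" "fst s x = u" for u s
  proof -
    have "I u N (run w (For y b ?p) s) \<and> fst (run w (For y b ?p) s) x = u"
    proof (rule run_For[where I = "\<lambda>v s. I u v s \<and> fst s x = u"])
      fix v s assume v: "v < N" "I u v s \<and> fst s x = u"
      let ?s = "run w p (set_reg y v s)"
      have "J u (Suc v) ?s"
        using that(1) v assms(3) by (intro step) (auto simp: I_def intro: stable)
      then have "J u (Suc v) (run w ?p (set_reg y v s))"
        by (auto intro: stable)
      then show "I u (Suc v) (run w ?p (set_reg y v s)) \<and> fst (run w ?p (set_reg y v s)) x = u"
        using v assms(3-6) by (auto simp: I_def run_frame)
    qed (use that in \<open>auto simp: I_def\<close>)
    then show ?thesis by blast
  qed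
  have "I N 0 (run w (For x b (For y b ?p)) (set_reg q ?B s))"
  proof (rule run_For[where I = "\<lambda>u s. I u 0 s"])
    fix u s assume u: "u < N" "I u 0 s"
    then have "I u 0 (set_reg x u s)"
      using assms(3) by (auto simp: I_def intro: stable)
    from inner[OF u(1) this] have "I u N (run w (For y b ?p) (set_reg x u s))" by simp
    then show "I (Suc u) 0 (run w (For y b ?p) (set_reg x u s))"
      by (auto simp: I_def intro: row)
  qed (use assms in \<open>auto simp: I_def intro: stable\<close>)
  then show ?thesis unfolding scan_def run.simps I_def s0 by blast
qed

lemma run_scan_fold:
  assumes "J s" "fst s b = N" "distinct [q, x, y, b]" "q \<notin> mods p" "x \<notin> mods p" "b \<notin> mods p"
    and stable: "\<And>r c s. r \<in> {q, x, y} \<Longrightarrow> J s \<Longrightarrow> J (set_reg r c s)"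
    and stable_view: "\<And>r c s. r \<in> {q, x, y} \<Longrightarrow> \<alpha> (set_reg r c s) = \<alpha> s"
    and step: "\<And>u v s'. \<lbrakk>u < N; v < N; J s'; fst s' x = u; fst s' y = v;
      fst s' q = eval w e s + u * N + v\<rbrakk> \<Longrightarrow> J (run w p s') \<and> \<alpha> (run w p s') = g u v (\<alpha> s')"
  shows "J (run w (scan q e x y b p) s) \<and>
    \<alpha> (run w (scan q e x y b p) s) = fold (\<lambda>u. fold (g u) [0..<N]) [0..<N] (\<alpha> s)"
proof -
  let ?J = "\<lambda>u v s'. J s' \<and>
    \<alpha> s' = fold (g u) [0..<v] (fold (\<lambda>u. fold (g u) [0..<N]) [0..<u] (\<alpha> s))"
  have "?J N 0 (run w (scan q e x y b p) s)"
    by (rule run_scan[where J = ?J and N = N and ?s0.0 = s]) (use assms in auto)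
  then show ?thesis by simp
qed

text \<open>The flag can only be cleared, so it acts as a universal quantifier; the negated flags of
  the programs give existential ones.\<close>

lemma fold_flag:
  "fold (\<lambda>x d. if B x then 0 else d) xs (d :: nat) \<noteq> 0 \<longleftrightarrow> d \<noteq> 0 \<and> (\<forall>x \<in> set xs. \<not> B x)"
  by (induction xs arbitrary: d) auto

lemma fold_flag2:
  "fold (\<lambda>x. fold (\<lambda>y d. if B x y then 0 else d) ys) xs (d :: nat) \<noteq> 0 \<longleftrightarrow>
     d \<noteq> 0 \<and> (\<forall>x \<in> set xs. \<forall>y \<in> set ys. \<not> B x y)"
proof (induction xs arbitrary: d)
  case (Cons x xs)
  then show ?case using fold_flag[of "B x" ys d] by auto
qed simp

text \<open>The start address \<open>n + 1\<close> skips the unary vertex count and its terminating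
  zero; the matrix of \<open>G\<close> comes next.\<close>

definition round_prog :: prog where
  "round_prog = scan r_q (Plus (Reg r_n) (Num 1)) r_x r_y r_n (
     When (And (Input (Reg r_q)) (And (Cell Tmp (Reg r_x)) (Neg (Cell Tmp (Reg r_y)))))
       (Write Tmp (Reg r_y) (Cell Partner (Cell Tmp (Reg r_x)))) ;;
     For r_z r_n (
       When (And (And (Less (Reg r_x) (Reg r_y)) (Less (Reg r_y) (Reg r_z)))
           (And (And (Cell Tmp (Reg r_x)) (Neg (Cell Tmp (Reg r_y))))
             (Eq (Cell Tmp (Reg r_z)) (Cell Tmp (Reg r_x)))))
         (Write Tmp (Reg r_y) (Cell Tmp (Reg r_x)))))"

definition check_prog :: prog where
  "check_prog =
     Assign r_good (Num 1) ;;
     scan r_q (Plus (Reg r_n) (Num 1)) r_x r_y r_n (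
       When (And (Cell Tmp (Reg r_x)) (Cell Tmp (Reg r_y))) (
         When (And (Input (Reg r_q)) (Neg (Eq (Cell Tmp (Reg r_y)) (Cell Partner (Cell Tmp (Reg r_x))))))
           (Assign r_good (Num 0)) ;;
         When (And (Less (Reg r_x) (Reg r_y)) (Less (Cell Tmp (Reg r_y)) (Cell Tmp (Reg r_x))))
           (Assign r_good (Num 0))))"

text \<open>The attempt runs on \<open>Tmp\<close>, so a conflict leaves \<open>Col\<close>
  untouched. Register \<open>r\<close> holds the colour minus one, which suits both a loop index and
  a digit.\<close>

definition try_prog :: "nat \<Rightarrow> prog" where
  "try_prog r =
     For r_x r_n (Write Tmp (Reg r_x) (Cell Col (Reg r_x))) ;;
     Write Tmp (Reg r_u) (Plus (Reg r) (Num 1)) ;;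
     For r_round r_n round_prog ;;
     check_prog ;;
     When (Reg r_good) (
       For r_x r_n (Write Col (Reg r_x) (Cell Tmp (Reg r_x))) ;;
       Assign r_done (Num 1))"

text \<open>
  The flag \<open>r_used\<close> is negated: it becomes 0 when the colour is in use. So is \<open>r_ans\<close>
  during the loop over all codes.
\<close>

definition used_prog :: prog where
  "used_prog =
     Assign r_used (Num 1) ;;
     For r_x r_n (When (Eq (Cell Col (Reg r_x)) (Plus (Reg r_a) (Num 1))) (Assign r_used (Num 0)))"

definition join_prog :: prog where
  "join_prog =
     Assign r_done (Num 0) ;;
     For r_a r_k (When (Neg (Reg r_done)) (used_prog ;; When (Neg (Reg r_used)) (try_prog r_a)))"

text \<open>Division by repeated subtraction. The code stays below \<open>r_codes\<close>, so this
  many iterations cover the quotient.\<close>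

definition div_prog :: prog where
  "div_prog =
     Assign r_quot (Num 0) ;;
     Assign r_rem (Reg r_code) ;;
     For r_i r_codes (When (Neg (Less (Reg r_rem) (Reg r_k)))
       (Assign r_rem (Minus (Reg r_rem) (Reg r_k)) ;; Assign r_quot (Plus (Reg r_quot) (Num 1))))"

definition visit_prog :: prog where
  "visit_prog =
     When (And (Input (Reg r_p)) (And (Neg (Cell Col (Reg r_u))) (Reg r_ok))) (
       join_prog ;;
       When (Neg (Reg r_done)) (div_prog ;; try_prog r_rem ;; Assign r_code (Reg r_quot)) ;;
       Assign r_ok (Reg r_done))"

definition search_prog :: prog where
  "search_prog =
     Assign r_ans (Num 1) ;;
     For r_t r_codes (
       Assign r_code (Reg r_t) ;;
       Assign r_ok (Num 1) ;;
       For r_v r_n (Write Col (Reg r_v) (Num 0)) ;;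
       scan r_p (Plus (Reg r_n) (Num 1)) r_u r_v r_n visit_prog ;;
       When (Reg r_ok) (Assign r_ans (Num 0))) ;;
     Assign r_ans (Neg (Reg r_ans))"

lemmas prog_defs = round_prog_def check_prog_def try_prog_def used_prog_def join_prog_def
  div_prog_def visit_prog_def search_prog_def

locale encoded_instance = matching_instance +
  fixes w :: "bool list"
  assumes k_pos: "k > 0"
    and input: "\<lbrakk>x < n; y < n\<rbrakk> \<Longrightarrow> input_bit w (n + 1 + x * n + y) = (if adj x y then 1 else 0)"
begin

section \<open>The program simulates the greedy search\<close>

definition ready :: "env \<Rightarrow> bool" where
  "ready s \<longleftrightarrow> fst s r_n = n \<and> fst s r_k = k \<and> fst s r_codes = 2 ^ (k * k) \<and>
     (\<forall>c \<in> {1..k}. snd s Partner c = mate c)"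

text \<open>Cutting off at \<open>n\<close> makes arrays that agree on the vertices equal as
  functions, so program states can be compared with colourings by plain equality.\<close>

definition view :: "arr \<Rightarrow> env \<Rightarrow> nat \<Rightarrow> nat" where
  "view a s x = (if x < n then snd s a x else 0)"

lemma ready_simps: "ready s \<Longrightarrow> fst s r_n = n" "ready s \<Longrightarrow> fst s r_k = k"
    "ready s \<Longrightarrow> fst s r_codes = 2 ^ (k * k)"
    "ready s \<Longrightarrow> 1 \<le> c \<Longrightarrow> c \<le> k \<Longrightarrow> snd s Partner c = mate c"
  by (auto simp: ready_def)

lemma ready_set_reg [simp]: "r \<notin> {r_n, r_k, r_codes} \<Longrightarrow> ready (set_reg r c s) = ready s"
  by (auto simp: ready_def)

lemma ready_set_cell [simp]: "a \<noteq> Partner \<Longrightarrow> ready (set_cell a i c s) = ready s"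
  by (auto simp: ready_def)

lemma ready_run:
  "\<lbrakk>ready s; mods p \<inter> {r_n, r_k, r_codes} = {}; Partner \<notin> writes p\<rbrakk> \<Longrightarrow> ready (run w p s)"
  using run_frame[of r_n p w s] run_frame[of r_k p w s] run_frame[of r_codes p w s]
  by (auto simp: ready_def run_frame_array)

lemma view_set_reg [simp]: "view a (set_reg r c s) = view a s"
  by (auto simp: view_def)

lemma view_set_cell [simp]:
  "view a (set_cell a' i c s) = (if a = a' \<and> i < n then (view a s)(i := c) else view a s)"
  by (auto simp: view_def)

lemma view_run: "a \<notin> writes p \<Longrightarrow> view a (run w p s) = view a s"
  by (simp add: view_def run_frame_array fun_eq_iff)

lemma cell_eq_view: "x < n \<Longrightarrow> snd s a x = view a s x"
  by (simp add: view_def)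

lemma copy_row:
  assumes "fst s r_n = n" "a \<noteq> a'"
  shows "view a (run w (For r_x r_n (Write a (Reg r_x) (Cell a' (Reg r_x)))) s) = view a' s"
    (is "view a (run w ?p s) = _")
proof -
  have "(\<forall>x < n. snd (run w ?p s) a x = snd s a' x) \<and> snd (run w ?p s) a' = snd s a'"
    by (rule run_For[where I = "\<lambda>j s'. (\<forall>x < j. snd s' a x = snd s a' x) \<and> snd s' a' = snd s a'"])
      (use assms in \<open>auto simp: less_Suc_eq\<close>)
  then show ?thesis by (auto simp: view_def)
qed

text \<open>\<open>colouring\<close> keeps every index into \<open>Partner\<close> within
  \<open>{1..k}\<close>, where the array agrees with \<open>mate\<close>.\<close>

lemma run_round_prog:
  assumes "ready s" "colouring (view Tmp s)"
  shows "view Tmp (run w round_prog s) = round (view Tmp s) \<and> ready (run w round_prog s)"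
proof -
  let ?J = "\<lambda>s. ready s \<and> colouring (view Tmp s)"
  have "?J (run w round_prog s) \<and> view Tmp (run w round_prog s) = round (view Tmp s)"
    unfolding round_prog_def round_def
  proof (rule run_scan_fold[where J = ?J and \<alpha> = "view Tmp"
        and g = "\<lambda>x y X. fold (between_rule x y) [0..<n] (edge_rule x y X)"])
    let ?e = "When (And (Input (Reg r_q)) (And (Cell Tmp (Reg r_x)) (Neg (Cell Tmp (Reg r_y)))))
       (Write Tmp (Reg r_y) (Cell Partner (Cell Tmp (Reg r_x))))"
    let ?b = "When (And (And (Less (Reg r_x) (Reg r_y)) (Less (Reg r_y) (Reg r_z)))
           (And (And (Cell Tmp (Reg r_x)) (Neg (Cell Tmp (Reg r_y))))
             (Eq (Cell Tmp (Reg r_z)) (Cell Tmp (Reg r_x)))))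
         (Write Tmp (Reg r_y) (Cell Tmp (Reg r_x)))"
    fix x y s' assume xy: "x < n" "y < n" and J: "?J s'" and regs: "fst s' r_x = x" "fst s' r_y = y"
      "fst s' r_q = eval w (Plus (Reg r_n) (Num 1)) s + x * n + y"
    let ?s = "run w ?e s'"
    have q: "input_bit w (fst s' r_q) = (if adj x y then 1 else 0)"
      using input[OF xy] regs assms(1) by (simp add: ready_simps)
    have "snd s' Partner (view Tmp s' x) = mate (view Tmp s' x)" if "view Tmp s' x \<noteq> 0"
      using J xy that by (intro ready_simps) (auto simp: colouring_def)
    then have e: "view Tmp ?s = edge_rule x y (view Tmp s')"
      using xy regs q by (simp add: edge_rule_def cell_eq_view)
    have e': "ready ?s" "colouring (view Tmp ?s)" "fst ?s r_x = x" "fst ?s r_y = y"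
      using J regs e xy colouring_edge_rule[of x "view Tmp s'" y]
      by (auto intro!: ready_run simp: run_frame)
    have "(?J (run w (For r_z r_n ?b) ?s) \<and> fst (run w (For r_z r_n ?b) ?s) r_x = x \<and>
        fst (run w (For r_z r_n ?b) ?s) r_y = y) \<and>
        view Tmp (run w (For r_z r_n ?b) ?s) = fold (between_rule x y) [0..<n] (view Tmp ?s)"
    proof (rule run_For_fold[where J = "\<lambda>s. ?J s \<and> fst s r_x = x \<and> fst s r_y = y"])
      fix z s assume z: "z < n" and s: "?J s \<and> fst s r_x = x \<and> fst s r_y = y"
      let ?s = "run w ?b (set_reg r_z z s)"
      have "view Tmp ?s = between_rule x y z (view Tmp s)"
        using s z xy by (auto simp: between_rule_def cell_eq_view)
      then show "(?J ?s \<and> fst ?s r_x = x \<and> fst ?s r_y = y) \<and>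
          view Tmp ?s = between_rule x y z (view Tmp s)"
        using s xy colouring_between_rule[of x "view Tmp s" y z] by simp
    qed (use e' in \<open>auto simp: ready_simps\<close>)
    from this[unfolded e] show "?J (run w (?e ;; For r_z r_n ?b) s') \<and>
        view Tmp (run w (?e ;; For r_z r_n ?b) s') =
        fold (between_rule x y) [0..<n] (edge_rule x y (view Tmp s'))"
      unfolding run.simps(4) by blast
  qed (use assms in \<open>auto simp: ready_simps\<close>)
  then show ?thesis by blast
qed

lemma run_closure:
  assumes "ready s" "colouring (view Tmp s)"
  shows "view Tmp (run w (For r_round r_n round_prog) s) = closure (view Tmp s) \<and>
    ready (run w (For r_round r_n round_prog) s)"
proof -
  let ?J = "\<lambda>s. ready s \<and> colouring (view Tmp s)"
  have "?J (run w (For r_round r_n round_prog) s) \<and>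
      view Tmp (run w (For r_round r_n round_prog) s) = fold (\<lambda>_. round) [0..<n] (view Tmp s)"
  proof (rule run_For_fold[where J = ?J])
    fix j s assume "?J s"
    then show "?J (run w round_prog (set_reg r_round j s)) \<and>
        view Tmp (run w round_prog (set_reg r_round j s)) = round (view Tmp s)"
      using run_round_prog[of "set_reg r_round j s"] progressive_round
      by (auto simp: progressive_def)
  qed (use assms in \<open>auto simp: ready_simps\<close>)
  then show ?thesis by (simp add: closure_def)
qed

lemma run_check_prog:
  assumes "ready s" "colouring (view Tmp s)"
  shows "fst (run w check_prog s) r_good \<noteq> 0 \<longleftrightarrow> consistent (view Tmp s)"
proof -
  let ?X = "view Tmp s"
  let ?bad = "\<lambda>x y. ?X x \<noteq> 0 \<and> ?X y \<noteq> 0 \<and> (adj x y \<and> ?X y \<noteq> mate (?X x) \<or> x < y \<and> ?X y < ?X x)"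
  let ?J = "\<lambda>s. ready s \<and> view Tmp s = ?X"
  let ?p = "When (And (Cell Tmp (Reg r_x)) (Cell Tmp (Reg r_y))) (
         When (And (Input (Reg r_q)) (Neg (Eq (Cell Tmp (Reg r_y)) (Cell Partner (Cell Tmp (Reg r_x))))))
           (Assign r_good (Num 0)) ;;
         When (And (Less (Reg r_x) (Reg r_y)) (Less (Cell Tmp (Reg r_y)) (Cell Tmp (Reg r_x))))
           (Assign r_good (Num 0)))"
  let ?s = "set_reg r_good 1 s"
  let ?q = "scan r_q (Plus (Reg r_n) (Num 1)) r_x r_y r_n ?p"
  have "?J (run w ?q ?s) \<and> fst (run w ?q ?s) r_good =
      fold (\<lambda>x. fold (\<lambda>y d. if ?bad x y then 0 else d) [0..<n]) [0..<n] (fst ?s r_good)"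
  proof (rule run_scan_fold[where J = ?J and \<alpha> = "\<lambda>s. fst s r_good"])
    fix x y s' assume xy: "x < n" "y < n" and J: "?J s'" and regs: "fst s' r_x = x" "fst s' r_y = y"
      "fst s' r_q = eval w (Plus (Reg r_n) (Num 1)) ?s + x * n + y"
    have q: "input_bit w (fst s' r_q) = (if adj x y then 1 else 0)"
      using input[OF xy] regs assms(1) by (simp add: ready_simps)
    have "snd s' Partner (?X x) = mate (?X x)" if "?X x \<noteq> 0"
      using J xy that assms(2) by (intro ready_simps) (auto simp: colouring_def)
    then show "?J (run w ?p s') \<and> fst (run w ?p s') r_good = (if ?bad x y then 0 else fst s' r_good)"
      using J xy regs(1,2) q by (auto simp: cell_eq_view)
  qed (use assms in \<open>auto simp: ready_simps\<close>)
  then have "fst (run w check_prog s) r_good =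
      fold (\<lambda>x. fold (\<lambda>y d. if ?bad x y then 0 else d) [0..<n]) [0..<n] 1"
    by (simp add: check_prog_def)
  then have "fst (run w check_prog s) r_good \<noteq> 0 \<longleftrightarrow> (\<forall>x \<in> {0..<n}. \<forall>y \<in> {0..<n}. \<not> ?bad x y)"
    by (simp only: fold_flag2) simp
  also have "\<dots> \<longleftrightarrow> consistent ?X" 
    by (simp only: consistent_def atLeast0LessThan Ball_def lessThan_iff not_less[symmetric]) blast
  finally show ?thesis .
qed

lemma check_prog_writes: "writes check_prog = {}" and check_prog_mods: "mods check_prog = {r_good, r_q, r_x, r_y}"
  by (auto simp: check_prog_def)

lemma round_prog_writes: "writes round_prog = {Tmp}" and round_prog_mods: "mods round_prog = {r_q, r_x, r_y, r_z}"
  by (auto simp: round_prog_def)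

text \<open>\<open>r\<close> is \<open>r_a\<close> when a colour in use is tried and
  \<open>r_rem\<close> when a digit of the code is.\<close>

lemma run_try_prog:
  assumes "ready s" "colouring (view Col s)" "fst s r_u = u" "u < n" "fst s r < k" "r \<in> {r_a, r_rem}"
  shows "view Col (run w (try_prog r) s) =
      (if consistent (attempt (view Col s) u (Suc (fst s r))) then attempt (view Col s) u (Suc (fst s r))
       else view Col s)"
    and "fst (run w (try_prog r) s) r_done =
      (if consistent (attempt (view Col s) u (Suc (fst s r))) then 1 else fst s r_done)"
proof -
  let ?X = "view Col s" and ?c = "Suc (fst s r)"
  let ?Y = "attempt ?X u ?c"
  let ?copy = "For r_x r_n (Write Tmp (Reg r_x) (Cell Col (Reg r_x)))"
  let ?back = "For r_x r_n (Write Col (Reg r_x) (Cell Tmp (Reg r_x)))"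
  define s1 where "s1 = run w ?copy s"
  define s2 where "s2 = run w (Write Tmp (Reg r_u) (Plus (Reg r) (Num 1))) s1"
  define s3 where "s3 = run w (For r_round r_n round_prog) s2"
  define s4 where "s4 = run w check_prog s3"
  have 1: "view Tmp s1 = ?X" "view Col s1 = ?X" "ready s1" "fst s1 r_u = u" "fst s1 r = fst s r"
    "fst s1 r_done = fst s r_done"
    unfolding s1_def using copy_row[of s Tmp Col] assms
    by (auto simp: ready_simps view_run run_frame intro!: ready_run)
  then have 2: "view Tmp s2 = ?X(u := ?c)" "view Col s2 = ?X" "ready s2"
    "fst s2 r_done = fst s r_done"
    unfolding s2_def using assms(4) by auto
  have "colouring (view Tmp s2)" using assms(2,5) 2(1) by (auto simp: colouring_def)
  with 2 run_closure[of s2] have 3: "view Tmp s3 = ?Y" "ready s3"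
    by (auto simp: s3_def attempt_def)
  have k3: "view Col s3 = ?X" "fst s3 r_done = fst s r_done"
    unfolding s3_def using 2 by (auto simp: view_run run_frame round_prog_writes round_prog_mods)
  have "colouring (view Tmp s3)"
    using \<open>colouring (view Tmp s2)\<close> closure(1) 2(1) 3(1) by (simp add: attempt_def)
  then have good: "fst s4 r_good \<noteq> 0 \<longleftrightarrow> consistent ?Y"
    unfolding s4_def using run_check_prog[OF 3(2)] 3(1) by simp
  have 4: "view Tmp s4 = ?Y" "ready s4" "view Col s4 = ?X" "fst s4 r_done = fst s r_done"
    unfolding s4_def using 3 k3
    by (auto simp: view_run run_frame check_prog_writes check_prog_mods intro!: ready_run)
  have run: "run w (try_prog r) s = run w (When (Reg r_good) (?back ;; Assign r_done (Num 1))) s4"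
    by (simp only: try_prog_def run.simps s4_def s3_def s2_def s1_def)
  show "view Col (run w (try_prog r) s) = (if consistent ?Y then ?Y else ?X)"
    unfolding run using good 4 copy_row[of s4 Col Tmp] by (auto simp: ready_simps)
  show "fst (run w (try_prog r) s) r_done = (if consistent ?Y then 1 else fst s r_done)"
    unfolding run using good 4 by auto
qed

lemma try_prog_writes: "writes (try_prog r) = {Col, Tmp}"
  and try_prog_mods: "mods (try_prog r) = {r_x, r_y, r_z, r_q, r_round, r_good, r_done}"
  by (auto simp: try_prog_def round_prog_writes round_prog_mods check_prog_writes check_prog_mods)

lemma colouring_attempt: "colouring X \<Longrightarrow> c \<le> k \<Longrightarrow> colouring (attempt X u c)"
  unfolding attempt_def by (intro closure(1)) (auto simp: colouring_def)

lemma run_used_prog: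
  assumes "ready s"
  shows "fst (run w used_prog s) r_used = 0 \<longleftrightarrow> Suc (fst s r_a) \<in> palette (view Col s)"
proof -
  let ?p = "When (Eq (Cell Col (Reg r_x)) (Plus (Reg r_a) (Num 1))) (Assign r_used (Num 0))"
  let ?J = "\<lambda>s'. view Col s' = view Col s \<and> fst s' r_a = fst s r_a"
  let ?s = "set_reg r_used 1 s"
  have "?J (run w (For r_x r_n ?p) ?s) \<and> fst (run w (For r_x r_n ?p) ?s) r_used =
      fold (\<lambda>x d. if view Col s x = Suc (fst s r_a) then 0 else d) [0..<n] (fst ?s r_used)"
    by (rule run_For_fold[where J = ?J and \<alpha> = "\<lambda>s. fst s r_used"])
      (use assms in \<open>auto simp: ready_simps cell_eq_view\<close>)
  then have "fst (run w used_prog s) r_used =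
      fold (\<lambda>x d. if view Col s x = Suc (fst s r_a) then 0 else d) [0..<n] 1"
    by (simp add: used_prog_def)
  moreover have "fold (\<lambda>x d. if view Col s x = Suc (fst s r_a) then 0 else d) [0..<n] 1 = (0 :: nat)
      \<longleftrightarrow> (\<exists>x < n. view Col s x = Suc (fst s r_a))"
    using fold_flag[of "\<lambda>x. view Col s x = Suc (fst s r_a)" "[0..<n]" 1] by auto
  ultimately show ?thesis by (force simp: palette_def)
qed

lemma used_prog_writes: "writes used_prog = {}" and used_prog_mods: "mods used_prog = {r_used, r_x}"
  by (auto simp: used_prog_def)

lemma run_join_prog:
  assumes "ready s" "colouring (view Col s)" "fst s r_u = u" "u < n"
  shows "ready (run w join_prog s) \<and> colouring (view Col (run w join_prog s)) \<and>
    (view Col (run w join_prog s), fst (run w join_prog s) r_done) = join u (view Col s)"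
proof -
  let ?p = "When (Neg (Reg r_done)) (used_prog ;; When (Neg (Reg r_used)) (try_prog r_a))"
  let ?J = "\<lambda>s. ready s \<and> colouring (view Col s) \<and> fst s r_u = u"
  let ?\<alpha> = "\<lambda>s. (view Col s, fst s r_done)"
  let ?s = "set_reg r_done 0 s"
  have "?J (run w (For r_a r_k ?p) ?s) \<and>
      ?\<alpha> (run w (For r_a r_k ?p) ?s) = fold (join_step u) [0..<k] (?\<alpha> ?s)"
  proof (rule run_For_fold[where J = ?J and \<alpha> = ?\<alpha>])
    fix a s assume a: "a < k" and J: "?J s"
    let ?s0 = "set_reg r_a a s"
    let ?s1 = "run w used_prog ?s0"
    let ?s2 = "run w (try_prog r_a) ?s1"
    have used: "fst ?s1 r_used = 0 \<longleftrightarrow> Suc a \<in> palette (view Col s)"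
      using run_used_prog[of ?s0] J by simp
    have 1: "ready ?s1" "colouring (view Col ?s1)" "fst ?s1 r_u = u" "fst ?s1 r_a = a"
      "view Col ?s1 = view Col s" "fst ?s1 r_done = fst s r_done"
      using J by (auto simp: view_run run_frame used_prog_writes used_prog_mods intro!: ready_run)
    have 2: "ready ?s2" "fst ?s2 r_u = u"
      using 1 by (auto simp: run_frame try_prog_writes try_prog_mods intro!: ready_run)
    note tried = run_try_prog[OF 1(1-3) assms(4), of r_a, unfolded 1(4-6), OF a]
    have "colouring (view Col ?s2)"
      using J tried(1) a colouring_attempt[of "view Col s" "Suc a" u] by auto
    with J 1 2 tried used show "?J (run w ?p ?s0) \<and> ?\<alpha> (run w ?p ?s0) = join_step u a (?\<alpha> s)"
      by (simp add: join_step_def)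
  qed (use assms in \<open>auto simp: ready_simps\<close>)
  then show ?thesis by (simp add: join_prog_def join_def)
qed

lemma join_prog_mods: "mods join_prog =
    {r_x, r_y, r_z, r_q, r_a, r_round, r_good, r_done, r_used}"
  by (auto simp: join_prog_def used_prog_mods try_prog_mods)

text \<open>After \<open>j\<close> iterations either the remainder is below \<open>k\<close> or at
  least \<open>j\<close> has been subtracted, as \<open>k > 0\<close>. The code is smaller than the
  number of iterations, so the second alternative is impossible at the end.\<close>

lemma run_div_prog:
  assumes "ready s" "fst s r_code < 2 ^ (k * k)"
  shows "fst (run w div_prog s) r_rem = fst s r_code mod k"
    and "fst (run w div_prog s) r_quot = fst s r_code div k"
proof -
  let ?c = "fst s r_code" and ?s = "set_reg r_rem (fst s r_code) (set_reg r_quot 0 s)"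
  let ?p = "When (Neg (Less (Reg r_rem) (Reg r_k)))
       (Assign r_rem (Minus (Reg r_rem) (Reg r_k)) ;; Assign r_quot (Plus (Reg r_quot) (Num 1)))"
  let ?I = "\<lambda>j s'. ready s' \<and> ?c = fst s' r_quot * k + fst s' r_rem \<and>
    (fst s' r_rem < k \<or> fst s' r_rem + j \<le> ?c)"
  have "?I (2 ^ (k * k)) (run w (For r_i r_codes ?p) ?s)"
    by (rule run_For[where I = ?I]) (use assms k_pos in \<open>auto simp: ready_simps\<close>)
  moreover have "run w div_prog s = run w (For r_i r_codes ?p) ?s"
    by (simp add: div_prog_def)
  ultimately have "?c = fst (run w div_prog s) r_quot * k + fst (run w div_prog s) r_rem"
    "fst (run w div_prog s) r_rem < k"
    using assms(2) by auto
  then show "fst (run w div_prog s) r_rem = ?c mod k" "fst (run w div_prog s) r_quot = ?c div k"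
    by simp_all
qed

lemma div_prog_writes: "writes div_prog = {}"
  and div_prog_mods: "mods div_prog = {r_quot, r_rem, r_i}"
  by (auto simp: div_prog_def)

definition search_state :: "env \<Rightarrow> (nat \<Rightarrow> nat) \<times> nat \<times> nat" where
  "search_state s = (view Col s, fst s r_code, fst s r_ok)"

text \<open>The bound on the code is what \<open>run_div_prog\<close> asks for; it persists because
  \<open>c div k \<le> c\<close>.\<close>

definition searching :: "env \<Rightarrow> bool" where
  "searching s \<longleftrightarrow> ready s \<and> colouring (view Col s) \<and> fst s r_code < 2 ^ (k * k)"

lemma search_set_reg:
  assumes "r \<in> {r_p, r_u, r_v}"
  shows "searching (set_reg r c s) = searching s" "search_state (set_reg r c s) = search_state s"
  using assms by (auto simp: searching_def search_state_def)

lemma run_visit_prog: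
  assumes "searching s" "u < n" "v < n" "fst s r_u = u" "fst s r_v = v" "fst s r_p = n + 1 + u * n + v"
  shows "searching (run w visit_prog s) \<and> search_state (run w visit_prog s) = visit (u, v) (search_state s)"
proof -
  let ?X = "view Col s" and ?c = "fst s r_code"
  have s: "ready s" "colouring ?X" "?c < 2 ^ (k * k)" using assms(1) by (auto simp: searching_def)
  have in_p: "input_bit w (fst s r_p) = (if adj u v then 1 else 0)"
    using input[OF assms(2,3)] assms(6) by simp
  have cell: "snd s Col u = ?X u" using assms(2) by (rule cell_eq_view)
  show ?thesis
  proof (cases "adj u v \<and> ?X u = 0 \<and> fst s r_ok \<noteq> 0")
    case False
    then have "run w visit_prog s = s" using in_p cell assms(4) by (auto simp: visit_prog_def)
    with False assms(1) show ?thesis by (auto simp: visit_def search_state_def)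
  next
    case True
    let ?w = "When (Neg (Reg r_done)) (div_prog ;; try_prog r_rem ;; Assign r_code (Reg r_quot))"
    define s1 where "s1 = run w join_prog s"
    obtain Y d where j: "join u ?X = (Y, d)" by fastforce
    have run: "run w visit_prog s = run w (?w ;; Assign r_ok (Reg r_done)) s1"
      using True in_p cell assms(4) unfolding visit_prog_def run_When by (simp add: s1_def)
    have 1: "ready s1" "colouring Y" "view Col s1 = Y" "fst s1 r_done = d"
      using run_join_prog[OF s(1,2) assms(4,2)] j by (auto simp: s1_def)
    have k1: "fst s1 r_u = u" "fst s1 r_code = ?c"
      unfolding s1_def using assms(4) by (simp_all add: run_frame join_prog_mods)
    show ?thesis
    proof (cases "d = 0")
      case False
      \<comment> \<open>\<open>r_ok\<close> receives the value of \<open>r_done\<close>, which must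
        be exactly the 1 returned by \<open>visit\<close>.\<close>
      with join_flag[of u ?X] j have "d = 1" by simp
      with 1 k1 s True j show ?thesis
        by (simp add: run searching_def search_state_def visit_def)
    next
      case d: True
      define s2 where "s2 = run w div_prog s1"
      define s3 where "s3 = run w (try_prog r_rem) s2"
      have code: "fst s1 r_code < 2 ^ (k * k)" using k1 s(3) by simp
      have 2: "fst s2 r_rem = ?c mod k" "fst s2 r_quot = ?c div k"
        unfolding s2_def using run_div_prog[OF 1(1) code] k1 by simp_all
      have k2: "ready s2" "colouring (view Col s2)" "fst s2 r_u = u" "view Col s2 = Y" "fst s2 r_done = 0"
        unfolding s2_def using 1 k1 d
        by (auto simp: view_run run_frame div_prog_writes div_prog_mods intro!: ready_run)
      have "?c mod k < k" using k_pos by simp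
      note tried = run_try_prog[OF k2(1-3) assms(2), of r_rem, unfolded 2 k2, OF this]
      have "ready s3" "fst s3 r_quot = ?c div k"
        unfolding s3_def using 2 k2
        by (auto simp: run_frame try_prog_writes try_prog_mods intro!: ready_run)
      moreover have "colouring (attempt Y u (Suc (?c mod k)))"
        using 1(2) \<open>?c mod k < k\<close> by (intro colouring_attempt) simp_all
      moreover have "?c div k < 2 ^ (k * k)"
        using s(3) by (meson div_le_dividend le_less_trans)
      moreover have "run w visit_prog s =
          set_reg r_ok (fst s3 r_done) (set_reg r_code (fst s3 r_quot) s3)"
        using d 1(4) by (simp add: run s2_def s3_def)
      ultimately show ?thesis
        using tried 1(2) True j d
        by (simp add: searching_def search_state_def visit_def s3_def)
    qed
  qed
qed

lemma visit_prog_mods: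
  "mods visit_prog =
    {r_x, r_y, r_z, r_q, r_a, r_round, r_good, r_done, r_used, r_quot, r_rem, r_i, r_code, r_ok}"
  by (auto simp: visit_prog_def join_prog_mods try_prog_mods div_prog_mods)

lemma run_search_prog:
  assumes "ready s"
  shows "fst (run w search_prog s) r_ans = (if \<exists>h. is_hom h then 1 else 0)"
proof -
  let ?clear = "For r_v r_n (Write Col (Reg r_v) (Num 0))"
  let ?scan = "scan r_p (Plus (Reg r_n) (Num 1)) r_u r_v r_n visit_prog"
  let ?p = "Assign r_code (Reg r_t) ;; Assign r_ok (Num 1) ;; ?clear ;; ?scan ;;
    When (Reg r_ok) (Assign r_ans (Num 0))"
  let ?s = "set_reg r_ans 1 s"
  have "ready (run w (For r_t r_codes ?p) ?s) \<and> fst (run w (For r_t r_codes ?p) ?s) r_ans =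
      fold (\<lambda>t d. if accepts t then 0 else d) [0..<2 ^ (k * k)] (fst ?s r_ans)"
  proof (rule run_For_fold[where J = ready and \<alpha> = "\<lambda>s. fst s r_ans"])
    fix t :: nat and s assume t: "t < 2 ^ (k * k)" and s: "ready s"
    define s0 where "s0 = set_reg r_ok 1 (set_reg r_code t (set_reg r_t t s))"
    define s1 where "s1 = run w ?clear s0"
    define s2 where "s2 = run w ?scan s1"
    have s0: "ready s0" using s by (simp add: s0_def)
    have "\<forall>x < n. snd s1 Col x = 0" unfolding s1_def
      by (rule run_For[where I = "\<lambda>j s. \<forall>x < j. snd s Col x = 0"])
        (use s0 in \<open>auto simp: ready_simps less_Suc_eq\<close>)
    \<comment> \<open>Thanks to the cut-off in \<open>view\<close>, clearing \<open>n\<close> cells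
      yields the constant function from which \<open>accepts\<close> starts.\<close>
    then have col: "view Col s1 = (\<lambda>_. 0)" by (auto simp: view_def)
    have 1: "ready s1" "fst s1 r_code = t" "fst s1 r_ok = 1" "fst s1 r_ans = fst s r_ans"
      unfolding s1_def using s0 by (auto intro!: ready_run simp: run_frame) (auto simp: s0_def)
    have "searching s1" using 1 col t by (simp add: searching_def colouring_def)
    note searching = this
    have n: "fst s1 r_n = n" using 1(1) by (rule ready_simps)
    have "searching s2 \<and> search_state s2 =
        fold (\<lambda>u. fold (\<lambda>v. visit (u, v)) [0..<n]) [0..<n] (search_state s1)"
      unfolding s2_def
    proof (rule run_scan_fold[where J = searching and \<alpha> = search_state and g = "\<lambda>u v. visit (u, v)"])
      fix u v s' assume "u < n" "v < n" "searching s'" "fst s' r_u = u" "fst s' r_v = v"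
        "fst s' r_p = eval w (Plus (Reg r_n) (Num 1)) s1 + u * n + v"
      with n show "searching (run w visit_prog s') \<and>
          search_state (run w visit_prog s') = visit (u, v) (search_state s')"
        by (intro run_visit_prog) simp_all
    qed (simp_all only: search_set_reg searching n, simp_all add: visit_prog_mods)
    moreover have "fst s2 r_ok = snd (snd (search_state s2))" by (simp add: search_state_def)
    moreover have "search_state s1 = (\<lambda>_. 0, t, 1)" using col 1 by (simp add: search_state_def)
    ultimately have "ready s2" "fst s2 r_ok \<noteq> 0 \<longleftrightarrow> accepts t"
      unfolding accepts_def by (simp_all add: searching_def)
    note s2 = this
    have "fst s2 r_ans = fst s r_ans"
      unfolding s2_def using 1(4) by (simp add: run_frame visit_prog_mods)
    note ans = this
    have run: "run w ?p (set_reg r_t t s) = run w (When (Reg r_ok) (Assign r_ans (Num 0))) s2"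
      by (simp add: s0_def s1_def s2_def)
    show "ready (run w ?p (set_reg r_t t s)) \<and>
        fst (run w ?p (set_reg r_t t s)) r_ans = (if accepts t then 0 else fst s r_ans)"
      unfolding run using s2 ans by auto
  qed (use assms in \<open>auto simp: ready_simps\<close>)
  then have "fst (run w search_prog s) r_ans =
      (if fold (\<lambda>t d. if accepts t then 0 else d) [0..<2 ^ (k * k)] (1 :: nat) = 0 then 1 else 0)"
    by (simp add: search_prog_def)
  then show ?thesis
    using fold_flag[of accepts "[0..<2 ^ (k * k)]" 1] hom_iff_accepts[OF k_pos] by auto
qed

end

section \<open>Graphs and their encodings\<close>

text \<open>Reads a unary number at address \<open>r_base\<close>. All loops are bounded, so the
  loop runs over the whole input length and \<open>r_stop\<close> freezes the count at the
  terminating zero.\<close>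

definition count_prog :: "nat \<Rightarrow> prog" where
  "count_prog r =
     Assign r (Num 0) ;; Assign r_stop (Num 0) ;;
     For r_i r_len (Cond (And (Neg (Reg r_stop)) (Input (Plus (Reg r_base) (Reg r_i))))
       (Assign r (Plus (Reg r) (Num 1))) (Assign r_stop (Num 1)))"

definition skip_matrix_prog :: prog where
  "skip_matrix_prog =
     Assign r_base (Plus (Reg r_n) (Num 1)) ;;
     For r_i r_n (Assign r_base (Plus (Reg r_base) (Reg r_n)))"

text \<open>The third loop makes one program serve twice: with \<open>r_stop\<close> equal to 1 it
  yields the number of codes, and with \<open>r_stop\<close> equal to a degree \<open>d\<close> the
  function \<open>2 ^ (n * n * d)\<close> of \<open>computable_power\<close>.\<close>

definition doubling_prog :: prog where
  "doubling_prog =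
     Assign r_codes (Num 1) ;;
     For r_i r_k (For r_j r_k (For r_u r_stop (Assign r_codes (Plus (Reg r_codes) (Reg r_codes)))))"

definition partner_prog :: prog where
  "partner_prog =
     scan r_p (Plus (Reg r_base) (Plus (Reg r_k) (Num 1))) r_u r_v r_k
       (When (Input (Reg r_p)) (Write Partner (Plus (Reg r_u) (Num 1)) (Plus (Reg r_v) (Num 1))))"

text \<open>The last line settles the empty matching, for which there are no colours and a
  homomorphism exists only from the empty graph; the result of the search is then
  overwritten.\<close>

definition hom_prog :: prog where
  "hom_prog =
     (Assign r_len Len ;; Assign r_base (Num 0)) ;; count_prog r_n ;; skip_matrix_prog ;;
     count_prog r_k ;; Assign r_stop (Num 1) ;; doubling_prog ;; partner_prog ;; search_prog ;;
     When (Neg (Reg r_k)) (Assign r_ans (Neg (Reg r_n)))"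

lemma count_prog_mods: "mods (count_prog r) = {r, r_stop, r_i}"
  by (auto simp: count_prog_def)

lemma run_count_prog:
  assumes "r \<in> {r_n, r_k}" "m < fst s r_len" "\<And>i. i < m \<Longrightarrow> input_bit w (fst s r_base + i) = 1"
    "input_bit w (fst s r_base + m) = 0"
  shows "fst (run w (count_prog r) s) r = m"
proof -
  let ?p = "Cond (And (Neg (Reg r_stop)) (Input (Plus (Reg r_base) (Reg r_i))))
       (Assign r (Plus (Reg r) (Num 1))) (Assign r_stop (Num 1))"
  let ?I = "\<lambda>j (s' :: env). fst s' r_base = fst s r_base \<and>
    (if j \<le> m then fst s' r_stop = 0 \<and> fst s' r = j else fst s' r_stop = 1 \<and> fst s' r = m)"
  let ?s = "set_reg r_stop 0 (set_reg r 0 s)"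
  have "?I (fst s r_len) (run w (For r_i r_len ?p) ?s)"
  proof (rule run_For[where I = ?I])
    fix j s' assume "?I j s'"
    then show "?I (Suc j) (run w ?p (set_reg r_i j s'))"
      using assms(1,3,4) by (cases "j < m"; cases "j = m") auto
  qed (use assms(1) in auto)
  then show ?thesis using assms(2) by (simp add: count_prog_def)
qed

lemma run_skip_matrix_prog:
  "fst (run w skip_matrix_prog s) r_base = fst s r_n + 1 + fst s r_n * fst s r_n"
proof -
  let ?p = "Assign r_base (Plus (Reg r_base) (Reg r_n))"
  let ?n = "fst s r_n" and ?s = "set_reg r_base (fst s r_n + 1) s"
  let ?I = "\<lambda>j (s' :: env). fst s' r_n = ?n \<and> fst s' r_base = ?n + 1 + j * ?n"
  have "?I ?n (run w (For r_i r_n ?p) ?s)"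
    by (rule run_For[where I = ?I]) auto
  then show ?thesis by (simp add: skip_matrix_prog_def)
qed

lemma run_doubling_prog:
  "fst (run w doubling_prog s) r_codes = 2 ^ (fst s r_k * fst s r_k * fst s r_stop)"
proof -
  let ?k = "fst s r_k" and ?d = "fst s r_stop"
  let ?p = "Assign r_codes (Plus (Reg r_codes) (Reg r_codes))"
  let ?J = "\<lambda>e (s' :: env). fst s' r_k = ?k \<and> fst s' r_stop = ?d \<and> fst s' r_codes = 2 ^ e"
  have 1: "?J (e + ?d) (run w (For r_u r_stop ?p) s')" if "?J e s'" for e s'
    by (rule run_For[where I = "\<lambda>l. ?J (e + l)"]) (use that in auto)
  have 2: "?J (e + ?k * ?d) (run w (For r_j r_k (For r_u r_stop ?p)) s')" if "?J e s'" for e s'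
  proof (rule run_For[where I = "\<lambda>l. ?J (e + l * ?d)"])
    fix l s' assume "?J (e + l * ?d) s'"
    then show "?J (e + Suc l * ?d) (run w (For r_u r_stop ?p) (set_reg r_j l s'))"
      using 1[of "set_reg r_j l s'" "e + l * ?d"] by (simp add: ac_simps)
  qed (use that in auto)
  have "?J (?k * (?k * ?d)) (run w (For r_i r_k (For r_j r_k (For r_u r_stop ?p))) (set_reg r_codes 1 s))"
  proof (rule run_For[where I = "\<lambda>l. ?J (l * (?k * ?d))"])
    fix l s' assume "?J (l * (?k * ?d)) s'"
    then show "?J (Suc l * (?k * ?d)) (run w (For r_j r_k (For r_u r_stop ?p)) (set_reg r_i l s'))"
      using 2[of "set_reg r_i l s'" "l * (?k * ?d)"] by (simp add: ac_simps)
  qed auto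
  then show ?thesis by (simp add: doubling_prog_def mult.assoc)
qed

text \<open>The invariant covers the entries before \<open>(u, v)\<close> in row order. A row
  contains a single 1, at the partner, so no cell already set is spoilt.\<close>

lemma run_partner_prog:
  assumes k: "fst s r_k = k"
    and bits: "\<And>a b. a < k \<Longrightarrow> b < k \<Longrightarrow>
      input_bit w (fst s r_base + k + 1 + a * k + b) = (if Suc b = mate (Suc a) then 1 else 0)"
    and range: "\<And>c. c \<in> {1..k} \<Longrightarrow> mate c \<in> {1..k}"
  shows "\<forall>c \<in> {1..k}. snd (run w partner_prog s) Partner c = mate c"
proof -
  let ?J = "\<lambda>u v (s' :: env). \<forall>a b. (a < u \<or> a = u \<and> b < v) \<and> a < k \<and> b < k \<and> Suc b = mate (Suc a) \<longrightarrow>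
    snd s' Partner (Suc a) = Suc b"
  have "?J k 0 (run w partner_prog s)"
    unfolding partner_prog_def
  proof (rule run_scan[where J = ?J and ?s0.0 = s])
    fix u v s' assume uv: "u < k" "v < k" and J: "?J u v s'" and regs: "fst s' r_u = u" "fst s' r_v = v"
      "fst s' r_p = eval w (Plus (Reg r_base) (Plus (Reg r_k) (Num 1))) s + u * k + v"
    have "input_bit w (fst s' r_p) = (if Suc v = mate (Suc u) then 1 else 0)"
      using bits[OF uv] regs k by (simp add: add.assoc)
    then show "?J u (Suc v) (run w (When (Input (Reg r_p))
        (Write Partner (Plus (Reg r_u) (Num 1)) (Plus (Reg r_v) (Num 1)))) s')"
      using J regs(1,2) by (auto simp: less_Suc_eq)
  qed (use k in \<open>auto simp: less_Suc_eq\<close>)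
  then have *: "snd (run w partner_prog s) Partner (Suc a) = Suc b"
    if "a < k" "b < k" "Suc b = mate (Suc a)" for a b
    using that by blast
  have "snd (run w partner_prog s) Partner c = mate c" if c: "c \<in> {1..k}" for c
  proof -
    obtain a where a: "c = Suc a" "a < k" using c by (cases c) auto
    obtain b where b: "mate c = Suc b" "b < k" using range[OF c] by (cases "mate c") auto
    from *[OF a(2) b(2)] show ?thesis using a b by simp
  qed
  then show ?thesis by blast
qed

section \<open>From loop programs to machine runs\<close>

definition init_env :: env where
  "init_env = (\<lambda>_. 0, \<lambda>_ _. 0)"

text \<open>Register 0 is overwritten only at the very end, since array addresses are computed from
  the length stored there.\<close>

definition output_com :: "prog \<Rightarrow> nat \<Rightarrow> com" where
  "output_com p r = Seq (compile p 0) (Seq (Const (tmp 0) 0) (Add 0 (var r) (tmp 0)))"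

lemma represents_input_state: "represents w init_env (input_state w)"
  by (auto simp: represents_def init_env_def input_state_def input_bit_def)

lemma exec_output:
  assumes "takes w p init_env T"
  shows "\<exists>t s. exec (output_com p r) (input_state w) t s \<and> t \<le> T + 2 \<and>
    fst s 0 = fst (run w p init_env) r"
proof -
  obtain R m where i: "input_state w = (R, m)" by fastforce
  with represents_input_state[of w] have "represents w init_env (R, m)" by simp
  from takesE[OF assms this, of 0] obtain T' R' m' where
    e: "exec (compile p 0) (R, m) T' (R', m')" "T' \<le> T" "represents w (run w p init_env) (R', m')"
      "\<And>j. j < 0 \<Longrightarrow> R' (tmp j) = R (tmp j)"
    by blast
  let ?R1 = "R'(tmp 0 := 0)"
  let ?R2 = "?R1(0 := ?R1 (var r) + ?R1 (tmp 0))"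
  have "exec (output_com p r) (R, m) (T' + (1 + 1)) (?R2, m')"
    unfolding output_com_def by (rule exec.Seq e(1) exec_simple)+
  moreover have "?R2 0 = fst (run w p init_env) r"
    using e(3) unfolding represents_def by simp
  moreover have "T' + (1 + 1) \<le> T + 2" using e(2) by simp
  ultimately show ?thesis unfolding i by (metis fst_conv)
qed

text \<open>Joins phases that share the bound \<open>B\<close>, even if the first one sets the loop
  bounds of the second, a case that \<open>takes_loops\<close> does not cover.\<close>

lemma takes_Then_cost:
  "\<lbrakk>takes w p s (cost p B); takes w q (run w p s) (cost q B)\<rbrakk> \<Longrightarrow> takes w (p ;; q) s (cost (p ;; q) B)"
  using takes_Then by simp

text \<open>The start state prescribed by \<open>computable\<close> is the input state of a string
  of \<open>n\<close> zeros, so the argument is available as the input length.\<close>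

lemma computable_power: "computable (\<lambda>n. 2 ^ (n * n * d))"
proof -
  let ?p = "(Assign r_k Len ;; Assign r_stop (Num d)) ;; doubling_prog"
  have "\<exists>t s. exec (output_com ?p r_codes) ((\<lambda>_. 0)(0 := n), \<lambda>_. 0) t s \<and> fst s 0 = 2 ^ (n * n * d)" for n
  proof -
    let ?w = "replicate n False"
    have "takes ?w ?p init_env (cost ?p (n + d))"
      by (intro takes_Then_cost takes_loops) (auto simp: doubling_prog_def)
    from exec_output[OF this, of r_codes] obtain t s where
      "exec (output_com ?p r_codes) (input_state ?w) t s" "fst s 0 = fst (run ?w ?p init_env) r_codes"
      by blast
    moreover have "input_state ?w = ((\<lambda>_. 0)(0 := n), \<lambda>_. 0)"
      by (auto simp: input_state_def)
    moreover have "fst (run ?w ?p init_env) r_codes = 2 ^ (n * n * d)"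
      by (simp add: run_doubling_prog)
    ultimately show ?thesis by metis
  qed
  then show ?thesis unfolding computable_def by blast
qed

section \<open>Locating the bits of an encoded graph\<close>

lemma concat_rows:
  assumes "i < length ys" "j < length xs"
  shows "i * length xs + j < length (concat (map (\<lambda>u. map (f u) xs) ys))"
    "concat (map (\<lambda>u. map (f u) xs) ys) ! (i * length xs + j) = f (ys ! i) (xs ! j)"
proof -
  have "i * length xs + j < length (concat (map (\<lambda>u. map (f u) xs) ys)) \<and>
    concat (map (\<lambda>u. map (f u) xs) ys) ! (i * length xs + j) = f (ys ! i) (xs ! j)"
    using assms
  proof (induction ys arbitrary: i)
    case (Cons y ys)
    then show ?case by (cases i) (auto simp: nth_append add.assoc)
  qed simp
  then show "i * length xs + j < length (concat (map (\<lambda>u. map (f u) xs) ys))"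
    "concat (map (\<lambda>u. map (f u) xs) ys) ! (i * length xs + j) = f (ys ! i) (xs ! j)" by auto
qed

lemma length_encode_ograph:
  "length (encode_ograph G) =
     length (vertex_list G) + 1 + length (vertex_list G) * length (vertex_list G)"
  by (simp add: encode_ograph_def Let_def length_concat comp_def sum_list_triv)

lemma encode_ograph_bits:
  fixes G :: "'a ograph"
  assumes w: "w = pre @ encode_ograph G @ post" and xs: "xs = vertex_list G"
  shows "i < length xs \<Longrightarrow> input_bit w (length pre + i) = 1"
    and "input_bit w (length pre + length xs) = 0"
    and "i < length xs \<Longrightarrow> j < length xs \<Longrightarrow>
      input_bit w (length pre + length xs + 1 + i * length xs + j) =
      (if {xs ! i, xs ! j} \<in> edges G then 1 else 0)"
proof -
  let ?A = "concat (map (\<lambda>u. map (\<lambda>v. {u, v} \<in> edges G) xs) xs)"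
  have w': "w = pre @ replicate (length xs) True @ False # ?A @ post"
    by (simp add: w encode_ograph_def xs Let_def)
  show "input_bit w (length pre + i) = 1" if "i < length xs"
    using that by (simp add: w' input_bit_def nth_append)
  show "input_bit w (length pre + length xs) = 0"
    by (simp add: w' input_bit_def nth_append)
  show "input_bit w (length pre + length xs + 1 + i * length xs + j) =
      (if {xs ! i, xs ! j} \<in> edges G then 1 else 0)" if "i < length xs" "j < length xs"
    using concat_rows[OF that, of "\<lambda>u v. {u, v} \<in> edges G"]
    by (simp add: w' input_bit_def nth_append)
qed

lemma le_vertex_list_iff:
  assumes "ordered_graph G" "i < length (vertex_list G)" "j < length (vertex_list G)"
  shows "(vertex_list G ! i, vertex_list G ! j) \<in> le G \<longleftrightarrow> i \<le> j"
proof -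
  let ?xs = "vertex_list G"
  note vl = vertex_list[OF assms(1)]
  have lin: "linear_order_on (verts G) (le G)" using assms(1) by (simp add: ordered_graph_def)
  then have refl: "refl_on (verts G) (le G)" and anti: "antisym (le G)"
    by (auto simp: order_on_defs)
  have less: "(?xs ! a, ?xs ! b) \<in> le G" if "a < b" "b < length ?xs" for a b
    using sorted_wrt_nth_less[OF vl(3) that] .
  have "?xs ! i \<in> verts G" using assms(2) vl(2) by (metis nth_mem)
  then have "(?xs ! i, ?xs ! j) \<in> le G" if "i \<le> j"
    using that less[of i j] assms(3) refl by (cases "i = j") (auto simp: refl_on_def)
  moreover have "i \<le> j" if "(?xs ! i, ?xs ! j) \<in> le G"
  proof (rule ccontr)
    assume "\<not> i \<le> j"
    then have "(?xs ! j, ?xs ! i) \<in> le G" using less[of j i] assms(2) by simp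
    with that anti have "?xs ! i = ?xs ! j" by (auto dest: antisymD)
    with \<open>\<not> i \<le> j\<close> assms(2,3) vl(1) show False by (simp add: nth_eq_iff_index_eq)
  qed
  ultimately show ?thesis by blast
qed

lemma ex1_partner:
  assumes "ordered_matching M" "i < length (vertex_list M)"
  shows "\<exists>!j. j < length (vertex_list M) \<and> {vertex_list M ! i, vertex_list M ! j} \<in> edges M"
proof -
  let ?ys = "vertex_list M"
  have M: "ordered_graph M" using assms(1) by (simp add: ordered_matching_def)
  note vl = vertex_list[OF M]
  have "?ys ! i \<in> verts M" using assms(2) vl(2) by (metis nth_mem)
  then obtain e where e: "e \<in> edges M" "?ys ! i \<in> e"
    and uniq: "\<And>e'. e' \<in> edges M \<Longrightarrow> ?ys ! i \<in> e' \<Longrightarrow> e' = e"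
    using assms(1) unfolding ordered_matching_def by metis
  have "e \<subseteq> verts M" "card e = 2" using M e(1) by (auto simp: ordered_graph_def)
  then obtain v where v: "e = {?ys ! i, v}" "v \<in> verts M"
    using e(2) by (auto simp: card_2_iff)
  then obtain j where j: "j < length ?ys" "?ys ! j = v" using vl(2) by (metis in_set_conv_nth)
  show ?thesis
  proof (rule ex1I[of _ j])
    show "j < length ?ys \<and> {?ys ! i, ?ys ! j} \<in> edges M" using e v j by simp
  next
    fix j' assume j': "j' < length ?ys \<and> {?ys ! i, ?ys ! j'} \<in> edges M"
    then have "{?ys ! i, ?ys ! j'} = {?ys ! i, ?ys ! j}" using uniq v(1) j(2) by auto
    then have "?ys ! j' = ?ys ! j" by (auto simp: doubleton_eq_iff)
    then show "j' = j" using j' j(1) vl(1) by (simp add: nth_eq_iff_index_eq)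
  qed
qed

section \<open>Ordered graphs as instances on positions and colours\<close>

definition matrix :: "'a ograph \<Rightarrow> nat \<Rightarrow> nat \<Rightarrow> bool" where
  "matrix G x y \<longleftrightarrow> {vertex_list G ! x, vertex_list G ! y} \<in> edges G"

text \<open>Colours start at 1 because 0 marks blanks, hence the shifts between colours and
  positions.\<close>

definition partner :: "'a ograph \<Rightarrow> nat \<Rightarrow> nat" where
  "partner M c =
     Suc (THE j. j < length (vertex_list M) \<and> {vertex_list M ! (c - 1), vertex_list M ! j} \<in> edges M)"

lemma partner_iff:
  assumes "ordered_matching M" "a < length (vertex_list M)" "b < length (vertex_list M)"
  shows "Suc b = partner M (Suc a) \<longleftrightarrow> {vertex_list M ! a, vertex_list M ! b} \<in> edges M"
  using theI'[OF ex1_partner[OF assms(1,2)]] ex1_partner[OF assms(1,2)] assms(3)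
  by (auto simp: partner_def)

lemma partner_range:
  assumes "ordered_matching M" "c \<in> {1..length (vertex_list M)}"
  shows "partner M c \<in> {1..length (vertex_list M)}"
proof -
  have "c - 1 < length (vertex_list M)" using assms(2) by auto
  from theI'[OF ex1_partner[OF assms(1) this]] show ?thesis by (simp add: partner_def Suc_le_eq)
qed

lemma matching_instance_of_graphs:
  assumes "ordered_matching M"
  shows "matching_instance n (length (vertex_list M)) (matrix G) (partner M)"
proof
  fix c assume c: "c \<in> {1..length (vertex_list M)}"
  show *: "partner M c \<in> {1..length (vertex_list M)}" using partner_range[OF assms c] .
  obtain a where a: "c = Suc a" "a < length (vertex_list M)" using c by (cases c) auto
  obtain b where b: "partner M c = Suc b" "b < length (vertex_list M)" using * by (cases "partner M c") auto
  have "{vertex_list M ! b, vertex_list M ! a} \<in> edges M"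
    using partner_iff[OF assms a(2) b(2)] a b by (simp add: insert_commute)
  then show "partner M (partner M c) = c"
    using partner_iff[OF assms b(2) a(2)] a b by simp
qed (simp add: matrix_def insert_commute)

text \<open>Vertices are exchanged for their positions in \<open>vertex_list\<close>, which turns
  both orders into the order of the natural numbers; images are moreover shifted by one to become
  colours.\<close>

lemma hom_iff_is_hom:
  assumes G: "ordered_graph G" and M: "ordered_matching M"
  shows "(\<exists>f. ordered_hom f G M) \<longleftrightarrow>
    (\<exists>h. matching_instance.is_hom (length (vertex_list G)) (length (vertex_list M)) (matrix G) (partner M) h)"
proof -
  let ?xs = "vertex_list G" and ?ys = "vertex_list M"
  interpret matching_instance "length ?xs" "length ?ys" "matrix G" "partner M"
    using M by (rule matching_instance_of_graphs)
  have M': "ordered_graph M" using M by (simp add: ordered_matching_def)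
  note xs = vertex_list[OF G] and ys = vertex_list[OF M']
  show ?thesis
  proof
    assume "\<exists>f. ordered_hom f G M"
    then obtain f where f: "\<And>v. v \<in> verts G \<Longrightarrow> f v \<in> verts M"
      "\<And>u v. {u, v} \<in> edges G \<Longrightarrow> {f u, f v} \<in> edges M"
      "\<And>u v. (u, v) \<in> le G \<Longrightarrow> (f u, f v) \<in> le M"
      unfolding ordered_hom_def by blast
    have "\<exists>j < length ?ys. ?ys ! j = f (?xs ! x)" if "x < length ?xs" for x
    proof -
      have "f (?xs ! x) \<in> set ?ys" using f(1)[of "?xs ! x"] that xs(2) ys(2) nth_mem by metis
      then show ?thesis by (simp add: in_set_conv_nth)
    qed
    then obtain g where g: "\<And>x. x < length ?xs \<Longrightarrow> g x < length ?ys \<and> ?ys ! g x = f (?xs ! x)"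
      by metis
    have "g x \<le> g y" if "x < y" "y < length ?xs" for x y
    proof -
      have "(?xs ! x, ?xs ! y) \<in> le G" using le_vertex_list_iff[OF G, of x y] that by simp
      from f(3)[OF this] show ?thesis
        using le_vertex_list_iff[OF M', of "g x" "g y"] g[of x] g[of y] that by simp
    qed
    moreover have "Suc (g y) = partner M (Suc (g x))"
      if "x < length ?xs" "y < length ?xs" "matrix G x y" for x y
    proof -
      have "{?ys ! g x, ?ys ! g y} \<in> edges M"
        using f(2)[of "?xs ! x" "?xs ! y"] g that by (simp add: matrix_def)
      then show ?thesis using partner_iff[OF M, of "g x" "g y"] g that by simp
    qed
    ultimately have "is_hom (\<lambda>x. Suc (g x))"
      using g unfolding is_hom_def by (auto simp: Suc_le_eq less_Suc_eq_le)
    then show "\<exists>h. is_hom h" by blast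
  next
    assume "\<exists>h. is_hom h"
    then obtain h where hom: "is_hom h" by blast
    then have h: "\<And>x. x < length ?xs \<Longrightarrow> h x \<in> {1..length ?ys}"
      "\<And>x y. x < y \<Longrightarrow> y < length ?xs \<Longrightarrow> h x \<le> h y"
      "\<And>x y. x < length ?xs \<Longrightarrow> y < length ?xs \<Longrightarrow> matrix G x y \<Longrightarrow> h y = partner M (h x)"
      by (simp_all add: is_hom_def)
    have "\<exists>x < length ?xs. ?xs ! x = v" if "v \<in> verts G" for v
      using that xs(2) by (metis in_set_conv_nth)
    then obtain pos where pos: "\<And>v. v \<in> verts G \<Longrightarrow> pos v < length ?xs \<and> ?xs ! pos v = v"
      by metis
    define g where "g v = h (pos v) - 1" for v
    have g: "g v < length ?ys" "h (pos v) = Suc (g v)" if "v \<in> verts G" for v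
      using h(1)[of "pos v"] pos[OF that] by (auto simp: g_def)
    have "ordered_hom (\<lambda>v. ?ys ! g v) G M"
      unfolding ordered_hom_def
    proof (intro conjI ballI allI impI)
      fix v assume "v \<in> verts G"
      then show "?ys ! g v \<in> verts M" using g(1) ys(2) by (metis nth_mem)
    next
      fix u v assume e: "{u, v} \<in> edges G"
      then have uv: "u \<in> verts G" "v \<in> verts G" using G by (auto simp: ordered_graph_def)
      have "matrix G (pos u) (pos v)" using e pos uv by (simp add: matrix_def)
      then have "Suc (g v) = partner M (Suc (g u))" using h(3)[of "pos u" "pos v"] pos uv g by simp
      then show "{?ys ! g u, ?ys ! g v} \<in> edges M"
        using partner_iff[OF M, of "g u" "g v"] g uv by simp
    next
      fix u v assume le: "(u, v) \<in> le G"
      \<comment> \<open>The order relation lives on vertices only, so \<open>pos\<close> is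
        meaningful for both arguments.\<close>
      have "le G \<subseteq> verts G \<times> verts G" using G by (auto simp: ordered_graph_def order_on_defs)
      with le have uv: "u \<in> verts G" "v \<in> verts G" by auto
      have "pos u \<le> pos v" using le_vertex_list_iff[OF G, of "pos u" "pos v"] pos uv le by simp
      then have "h (pos u) \<le> h (pos v)" using h(2)[of "pos u" "pos v"] pos uv by (cases "pos u = pos v") auto
      then have "g u \<le> g v" using g uv by simp
      then show "(?ys ! g u, ?ys ! g v) \<in> le M" using le_vertex_list_iff[OF M', of "g u" "g v"] g uv by simp
    qed
    then show "\<exists>f. ordered_hom f G M" by blast
  qed
qed

text \<open>The bound dominates every loop bound that occurs: the input length, \<open>n\<close>,
  \<open>k\<close>, the value 1 of \<open>r_stop\<close> and the number of codes.\<close>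

lemma hom_prog:
  assumes G: "ordered_graph G" and M: "ordered_matching M"
  defines "w \<equiv> encode_pair (G, M)" and "k \<equiv> card (verts M)"
  shows "takes w hom_prog init_env (cost hom_prog (Suc (length w) * 2 ^ (k * k)))"
    and "fst (run w hom_prog init_env) r_ans = (if \<exists>f. ordered_hom f G M then 1 else 0)"
proof -
  let ?n = "length (vertex_list G)" and ?B = "Suc (length w) * 2 ^ (k * k)"
  have M': "ordered_graph M" using M by (simp add: ordered_matching_def)
  have k: "length (vertex_list M) = k"
    unfolding k_def using vertex_list(1,2)[OF M'] distinct_card by metis
  have w: "w = [] @ encode_ograph G @ encode_ograph M" "w = encode_ograph G @ encode_ograph M @ []"
    by (simp_all add: w_def encode_pair_def)
  note bits_G = encode_ograph_bits[OF w(1) refl, unfolded list.size add_0]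
  note bits_M = encode_ograph_bits[OF w(2) refl, unfolded k]
  have len: "?n < length w" "k < length w"
    using w(1) length_encode_ograph[of G] length_encode_ograph[of M] k by auto
  define s1 where "s1 = run w (Assign r_len Len ;; Assign r_base (Num 0)) init_env"
  define s2 where "s2 = run w (count_prog r_n) s1"
  define s3 where "s3 = run w skip_matrix_prog s2"
  define s4 where "s4 = run w (count_prog r_k) s3"
  define s5 where "s5 = run w (Assign r_stop (Num 1)) s4"
  define s6 where "s6 = run w doubling_prog s5"
  define s7 where "s7 = run w partner_prog s6"
  define s8 where "s8 = run w search_prog s7"
  have 1: "fst s1 r_len = length w" "fst s1 r_base = 0"
    by (simp_all add: s1_def)
  have 2: "fst s2 r_len = length w" "fst s2 r_n = ?n"
    unfolding s2_def using 1 bits_G(1,2) len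
    by (auto simp: count_prog_mods run_frame intro!: run_count_prog)
  have 3: "fst s3 r_len = length w" "fst s3 r_n = ?n" "fst s3 r_base = length (encode_ograph G)"
    unfolding s3_def run_skip_matrix_prog using 2
    by (auto simp: skip_matrix_prog_def run_frame length_encode_ograph)
  have 4: "fst s4 r_len = length w" "fst s4 r_n = ?n" "fst s4 r_base = length (encode_ograph G)" "fst s4 r_k = k"
    unfolding s4_def using 3 bits_M(1,2) len
    by (auto simp: count_prog_mods run_frame intro!: run_count_prog)
  have 5: "fst s5 r_n = ?n" "fst s5 r_base = length (encode_ograph G)" "fst s5 r_k = k" "fst s5 r_stop = 1"
    unfolding s5_def using 4 by auto
  have 6: "fst s6 r_n = ?n" "fst s6 r_base = length (encode_ograph G)" "fst s6 r_k = k"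
    "fst s6 r_codes = 2 ^ (k * k)"
    unfolding s6_def run_doubling_prog using 5 by (auto simp: doubling_prog_def run_frame)
  have 7: "fst s7 r_n = ?n" "fst s7 r_k = k" "fst s7 r_codes = 2 ^ (k * k)"
    unfolding s7_def using 6 by (auto simp: partner_prog_def run_frame)
  have partner: "\<forall>c \<in> {1..k}. snd s7 Partner c = partner M c"
    unfolding s7_def using 6 bits_M(3) partner_iff[OF M] partner_range[OF M] k
    by (intro run_partner_prog) (auto simp: matrix_def)
  have mods: "r_n \<notin> mods search_prog" "r_k \<notin> mods search_prog" "r_codes \<notin> mods search_prog"
    "bounds search_prog \<subseteq> {r_n, r_k, r_codes}"
    by (auto simp: prog_defs)
  have 8: "fst s8 r_n = ?n" "fst s8 r_k = k"
    unfolding s8_def using 7 mods by (auto simp: run_frame)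
  have run: "run w hom_prog init_env = run w (When (Neg (Reg r_k)) (Assign r_ans (Neg (Reg r_n)))) s8"
    by (simp only: hom_prog_def run.simps s1_def s2_def s3_def s4_def s5_def s6_def s7_def s8_def)
  have B: "length w \<le> ?B" "2 ^ (k * k) \<le> ?B" "?n \<le> ?B" "k \<le> ?B" "1 \<le> ?B"
  proof -
    have "Suc (length w) * 1 \<le> ?B" by (intro mult_le_mono2) simp
    then have "Suc (length w) \<le> ?B" by (simp only: mult_1_right)
    then have le: "x \<le> ?B" if "x \<le> Suc (length w)" for x
      by (rule order_trans[OF that])
    show "length w \<le> ?B" "?n \<le> ?B" "k \<le> ?B" "1 \<le> ?B" by (rule le, use len in simp)+
  qed simp
  \<comment> \<open>Phases are peeled off one at a time: counting and doubling modify registers that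
    bound the loops of later phases.\<close>
  show "takes w hom_prog init_env (cost hom_prog ?B)"
    unfolding hom_prog_def
  proof (rule takes_Then_cost, goal_cases)
    case 1
    show ?case by (rule takes_loops) auto
  next
    case 2
    show ?case unfolding s1_def[symmetric]
    proof (rule takes_Then_cost, goal_cases)
      case 1
      show ?case by (rule takes_loops) (use \<open>fst s1 r_len = length w\<close> B in \<open>auto simp: count_prog_def\<close>)
    next
      case 2
      show ?case unfolding s2_def[symmetric]
      proof (rule takes_Then_cost, goal_cases)
        case 1
        show ?case by (rule takes_loops) (use \<open>fst s2 r_n = ?n\<close> B in \<open>auto simp: skip_matrix_prog_def\<close>)
      next
        case 2
        show ?case unfolding s3_def[symmetric]
        proof (rule takes_Then_cost, goal_cases)
          case 1
          show ?case by (rule takes_loops) (use 3 B in \<open>auto simp: count_prog_def\<close>)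
        next
          case 2
          show ?case unfolding s4_def[symmetric]
          proof (rule takes_Then_cost, goal_cases)
            case 1
            show ?case by (rule takes_loops) auto
          next
            case 2
            show ?case unfolding s5_def[symmetric]
            proof (rule takes_Then_cost, goal_cases)
              case 1
              show ?case by (rule takes_loops) (use 5 B in \<open>auto simp: doubling_prog_def\<close>)
            next
              case 2
              show ?case unfolding s6_def[symmetric]
              proof (rule takes_Then_cost, goal_cases)
                case 1
                show ?case by (rule takes_loops) (use 6 B in \<open>auto simp: partner_prog_def\<close>)
              next
                case 2
                show ?case unfolding s7_def[symmetric]
                proof (rule takes_Then_cost, goal_cases)
                  case 1
                  show ?case by (rule takes_loops) (use 7 B mods in auto)
                next
                  case 2
                  show ?case unfolding s8_def[symmetric] by (rule takes_loops) auto
                qed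
              qed
            qed
          qed
        qed
      qed
    qed
  qed
  show "fst (run w hom_prog init_env) r_ans = (if \<exists>f. ordered_hom f G M then 1 else 0)"
  proof (cases "k = 0")
    case True
    interpret matching_instance ?n k "matrix G" "partner M"
      using matching_instance_of_graphs[OF M] k by metis
    have "(\<exists>f. ordered_hom f G M) \<longleftrightarrow> (\<exists>h. is_hom h)"
      using hom_iff_is_hom[OF G M] k by simp
    also have "\<dots> \<longleftrightarrow> ?n = 0" unfolding is_hom_def using True by auto
    finally show ?thesis using run 8 True by simp
  next
    case False
    interpret matching_instance ?n k "matrix G" "partner M"
      using matching_instance_of_graphs[OF M] k by metis
    interpret encoded_instance ?n k "matrix G" "partner M" w
      by unfold_locales (use False bits_G(3) in \<open>simp_all add: matrix_def\<close>)
    have "ready s7" using 7 partner by (simp add: ready_def)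
    from run_search_prog[OF this] show ?thesis
      using run 8 False hom_iff_is_hom[OF G M] k by (simp add: s8_def)
  qed
qed

theorem theorem3:
  shows "fpt {(G :: nat ograph, M :: nat ograph). ordered_graph G \<and> ordered_matching M}
     encode_pair
     (\<lambda>(G, M). card (verts M))
     (\<lambda>(G, M). \<exists>f. ordered_hom f G M)"
proof -
  from cost_polynomial[of hom_prog] obtain C D where CD: "\<And>B. cost hom_prog B \<le> C * Suc B ^ D"
    by blast
  \<comment> \<open>The \<open>D\<close>-th power of the number \<open>2 ^ (k * k)\<close> of
    codes.\<close>
  define f where "f k = (2 :: nat) ^ (k * k * D)" for k
  \<comment> \<open>\<open>2 * D\<close> comes from \<open>Suc ?B \<le> ?l * ?B\<close>, where
    \<open>?B\<close> contains a second factor \<open>?l\<close>; \<open>C + 2\<close> is spent on a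
    constant factor.\<close>
  let ?d = "2 * D + (C + 2)"
  have "answers_within (output_com hom_prog r_ans) (encode_pair (G, M))
      (f (card (verts M)) * Suc (length (encode_pair (G, M))) ^ ?d) (\<exists>f. ordered_hom f G M)"
    if G: "ordered_graph G" and M: "ordered_matching M" for G M :: "nat ograph"
  proof -
    let ?w = "encode_pair (G, M)" and ?k = "card (verts M)"
    let ?l = "Suc (length ?w)"
    let ?B = "?l * 2 ^ (?k * ?k)"
    \<comment> \<open>Each of the two encodings has a terminating bit, so even empty graphs make
      \<open>?l\<close> at least 2.\<close>
    have len: "2 \<le> ?l" by (simp add: encode_pair_def length_encode_ograph)
    have "1 \<le> ?B" by (simp add: Suc_le_eq)
    then have "Suc ?B \<le> 2 * ?B" by linarith
    also have "\<dots> \<le> ?l * ?B" using len by (rule mult_le_mono1)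
    finally have "Suc ?B ^ D \<le> (?l * ?B) ^ D" by (rule power_mono) simp
    also have "(l * (l * X)) ^ D = X ^ D * l ^ (2 * D)" for l X :: nat
      by (simp add: power_mult_distrib power_mult power2_eq_square mult_ac)
    also have "(2 ^ (?k * ?k)) ^ D = f ?k" by (simp only: f_def power_mult)
    finally have poly: "Suc ?B ^ D \<le> f ?k * ?l ^ (2 * D)" .
    \<comment> \<open>The form of the time bound in \<open>fpt\<close> has no room for a constant
      factor, which is therefore absorbed into the exponent of \<open>?l\<close>; the summand 2 is
      the cost of the output.\<close>
    have "C + 2 \<le> 2 ^ (C + 2)" by (rule less_imp_le) (rule less_exp)
    also have "\<dots> \<le> ?l ^ (C + 2)" using len by (rule power_mono) simp
    finally have const: "C + 2 \<le> ?l ^ (C + 2)" .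
    have "cost hom_prog ?B + 2 \<le> C * Suc ?B ^ D + 2 * Suc ?B ^ D"
      by (intro add_mono CD) simp
    also have "\<dots> = (C + 2) * Suc ?B ^ D" by (simp add: distrib_right)
    also have "\<dots> \<le> ?l ^ (C + 2) * (f ?k * ?l ^ (2 * D))"
      using const poly by (rule mult_le_mono)
    also have "\<dots> = f ?k * ?l ^ ?d" by (simp only: power_add mult_ac)
    finally have time: "cost hom_prog ?B + 2 \<le> f ?k * ?l ^ ?d" .
    from exec_output[OF hom_prog(1)[OF G M], of r_ans] obtain t s where
      run: "exec (output_com hom_prog r_ans) (input_state ?w) t s" "t \<le> cost hom_prog ?B + 2"
        "fst s 0 = fst (run ?w hom_prog init_env) r_ans" by blast
    from run(2) time have "t \<le> f ?k * ?l ^ ?d" by (rule order_trans)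
    with run(1,3) hom_prog(2)[OF G M] show ?thesis
      unfolding answers_within_def by (intro exI[of _ t] exI[of _ s]) simp
  qed
  moreover have "computable f" unfolding f_def by (rule computable_power)
  ultimately show ?thesis unfolding fpt_def
    by (intro exI[of _ "output_com hom_prog r_ans"] exI[of _ f] exI[of _ ?d] conjI) auto
qed

end
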